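(* Let $P(z),q(z)\in\mathbb{C}[z]$ with $P$ non-constant, $n=\deg P$, and let $a,b\in\mathbb{C}$, $a\neq b$. Suppose that $Q(z)=\int q(z)\,dz$ is an antiderivative of $q$ with $Q(a)=Q(b)=0$. Let $\tilde\lambda_P=\tilde\lambda_P(c_1,\dots,c_{\tilde k})$ be an extended cactus corresponding to $P,a,b$, let $U$ be the associated simply connected domain, and let $\phi_s(z)=\sum_{i=1}^n f_{s,i}\,Q(P_i^{-1}(z))$, $1\le s\le\tilde k$, be the functions on $U$ attached to it (all defined in the context). Then $$\int_a^b P^i(z)q(z)\,dz=0\quad\text{for all integers } i\ge 0$$ holds if and only if $\phi_s(z)\equiv 0$ in $U$ for every $s$, $1\le s\le\tilde k$.
   Context: Extended cactus. Let $c_1,\dots,c_{\tilde k}$ be the distinct points consisting of all finite critical values of $P$ together with $P(a)$ and $P(b)$. Choose a point $c\in\mathbb{C}\setminus\{c_1,\dots,c_{\tilde k}\}$ and a star $S$: a union of simple arcs $\gamma_1,\dots,\gamma_{\tilde k}$, where $\gamma_s$ joins $c$ to $c_s$, the arcs pairwise meeting only at $c$. The extended cactus is $\tilde\lambda_P=P^{-1}(S)$, viewed as a plane graph: its vertices are the points of $P^{-1}(c)$ (called white) and the points of $P^{-1}(c_s)$ (said to have color $s$), and its edges are the preimages of the arcs $\gamma_s$. This graph is a tree, and $a,b$ are non-white vertices of it. Let $\Gamma_{a,b}\subset\tilde\lambda_P$ be the unique simple path in the tree, oriented from $a$ to $b$. Branches and stars. Let $U\subset\mathbb{C}$ be a simply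 connected domain containing no critical values of $P$ and such that $S\setminus\{c_1,\dots,c_{\tilde k}\}\subset U$. Let $P_1^{-1}(z),\dots,P_n^{-1}(z)$ be the $n$ single-valued branches of $P^{-1}(z)$ in $U$. The star $S_i$ of $\tilde\lambda_P$ is the closure of $P_i^{-1}(S\setminus\{c_1,\dots,c_{\tilde k}\})$; it has one white vertex $P_i^{-1}(c)$ (its center) and exactly one vertex of each color $s$. Coefficients $f_{s,i}\in\{0,1,-1\}$. If $\Gamma_{a,b}$ contains the edge of $S_i$ joining its center to its vertex $v$ of color $s$, then $f_{s,i}=-1$ if, moving along $\Gamma_{a,b}$ from $a$ to $b$, $v$ is followed by the center of $S_i$, and $f_{s,i}=1$ if the center of $S_i$ is followed by $v$. Otherwise $f_{s,i}=0$ (in particular if $\Gamma_{a,b}\cap S_i$ is only the point $v$). *)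

theory Defs
  imports "HOL-Complex_Analysis.Complex_Analysis" "Graph_Theory.Arc_Walk"
begin

definition critical_values :: "complex poly \<Rightarrow> complex set" where
  "critical_values P = poly P ` {z. poly (pderiv P) z = 0}"

text \<open>The points \<open>cs 1, \<dots>, cs k\<close> are pairwise distinct and are exactly the finite critical values
  of \<open>P\<close> together with \<open>P(a)\<close> and \<open>P(b)\<close>.\<close>

definition cactus_colors :: "complex poly \<Rightarrow> complex \<Rightarrow> complex \<Rightarrow> nat \<Rightarrow> (nat \<Rightarrow> complex) \<Rightarrow> bool" where
  "cactus_colors P a b k cs \<longleftrightarrow>
     bij_betw cs {1..k} (critical_values P \<union> {poly P a, poly P b})"

definition star_arcs :: "nat \<Rightarrow> (nat \<Rightarrow> complex) \<Rightarrow> complex \<Rightarrow> (nat \<Rightarrow> real \<Rightarrow> complex) \<Rightarrow> bool" where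
  "star_arcs k cs c \<gamma> \<longleftrightarrow>
     c \<notin> cs ` {1..k} \<and>
     (\<forall>s\<in>{1..k}. arc (\<gamma> s) \<and> pathstart (\<gamma> s) = c \<and> pathfinish (\<gamma> s) = cs s) \<and>
     (\<forall>s\<in>{1..k}. \<forall>t\<in>{1..k}. s \<noteq> t \<longrightarrow> path_image (\<gamma> s) \<inter> path_image (\<gamma> t) = {c})"

definition star_set :: "nat \<Rightarrow> (nat \<Rightarrow> real \<Rightarrow> complex) \<Rightarrow> complex set" where
  "star_set k \<gamma> = (\<Union>s\<in>{1..k}. path_image (\<gamma> s))"

text \<open>The preimage of an arc \<open>\<gamma> s\<close> under \<open>P\<close> is the union of the lifts of \<open>\<gamma> s\<close>.\<close>

definition lifts :: "complex poly \<Rightarrow> (real \<Rightarrow> complex) \<Rightarrow> (real \<Rightarrow> complex) set" where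
  "lifts P g = {h. path h \<and> (\<forall>t\<in>{0..1}. poly P (h t) = g t)}"

text \<open>The preimage of the star as a plane graph. Its edges are the lifts of the arcs \<open>\<gamma> s\<close>, regarded
  as subsets of the plane. As usual for digraphs, an undirected edge \<open>e\<close> with endpoints \<open>u\<close>, \<open>v\<close> is
  represented by the two opposite arcs \<open>(u, e, v)\<close> and \<open>(v, e, u)\<close>.\<close>

definition extended_cactus :: "complex poly \<Rightarrow> nat \<Rightarrow> (nat \<Rightarrow> complex) \<Rightarrow> complex \<Rightarrow>
    (nat \<Rightarrow> real \<Rightarrow> complex) \<Rightarrow> (complex, complex \<times> complex set \<times> complex) pre_digraph" where
  "extended_cactus P k cs c \<gamma> =
     \<lparr> verts = {z. poly P z \<in> insert c (cs ` {1..k})},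
       arcs = (\<Union>s\<in>{1..k}. \<Union>h\<in>lifts P (\<gamma> s).
                 {(pathstart h, path_image h, pathfinish h),
                  (pathfinish h, path_image h, pathstart h)}),
       tail = (\<lambda>(u, e, v). u),
       head = (\<lambda>(u, e, v). v) \<rparr>"

text \<open>The simple path from \<open>a\<close> to \<open>b\<close> in the extended cactus, as the list of its oriented edges;
  it exists and is unique since the cactus is a tree.\<close>

definition cactus_path :: "complex poly \<Rightarrow> complex \<Rightarrow> complex \<Rightarrow> nat \<Rightarrow> (nat \<Rightarrow> complex) \<Rightarrow> complex \<Rightarrow>
    (nat \<Rightarrow> real \<Rightarrow> complex) \<Rightarrow> (complex \<times> complex set \<times> complex) list" where
  "cactus_path P a b k cs c \<gamma> = (THE p. pre_digraph.apath (extended_cactus P k cs c \<gamma>) a p b)"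

text \<open>Note that \<open>simply_connected\<close> includes connectedness, and that \<open>U\<close> contains the centre \<open>c\<close>.\<close>

definition star_domain :: "complex poly \<Rightarrow> nat \<Rightarrow> (nat \<Rightarrow> complex) \<Rightarrow> (nat \<Rightarrow> real \<Rightarrow> complex) \<Rightarrow>
    complex set \<Rightarrow> bool" where
  "star_domain P k cs \<gamma> U \<longleftrightarrow>
     open U \<and> simply_connected U \<and> U \<inter> critical_values P = {} \<and>
     star_set k \<gamma> - cs ` {1..k} \<subseteq> U"

text \<open>\<open>B 1, \<dots>, B n\<close> with \<open>n = degree P\<close> are all the single-valued branches of the inverse of \<open>P\<close>
  on \<open>U\<close>, each listed once.\<close>

definition inverse_branches :: "complex poly \<Rightarrow> complex set \<Rightarrow> (nat \<Rightarrow> complex \<Rightarrow> complex) \<Rightarrow> bool" where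
  "inverse_branches P U B \<longleftrightarrow>
     (\<forall>i\<in>{1..degree P}. B i holomorphic_on U) \<and>
     (\<forall>z\<in>U. bij_betw (\<lambda>i. B i z) {1..degree P} {w. poly P w = z})"

definition cactus_star :: "nat \<Rightarrow> (nat \<Rightarrow> complex) \<Rightarrow> (nat \<Rightarrow> real \<Rightarrow> complex) \<Rightarrow>
    (nat \<Rightarrow> complex \<Rightarrow> complex) \<Rightarrow> nat \<Rightarrow> complex set" where
  "cactus_star k cs \<gamma> B i = closure (B i ` (star_set k \<gamma> - cs ` {1..k}))"

definition cactus_coeff :: "complex poly \<Rightarrow> complex \<Rightarrow> complex \<Rightarrow> nat \<Rightarrow> (nat \<Rightarrow> complex) \<Rightarrow> complex \<Rightarrow>
    (nat \<Rightarrow> real \<Rightarrow> complex) \<Rightarrow> (nat \<Rightarrow> complex \<Rightarrow> complex) \<Rightarrow> nat \<Rightarrow> nat \<Rightarrow> int" where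
  "cactus_coeff P a b k cs c \<gamma> B s i =
     (let \<Gamma> = set (cactus_path P a b k cs c \<gamma>); w = B i c in
      if \<exists>v e. poly P v = cs s \<and> e \<subseteq> cactus_star k cs \<gamma> B i \<and> (v, e, w) \<in> \<Gamma> then -1
      else if \<exists>v e. poly P v = cs s \<and> e \<subseteq> cactus_star k cs \<gamma> B i \<and> (w, e, v) \<in> \<Gamma> then 1
      else 0)"

definition cactus_phi :: "complex poly \<Rightarrow> complex poly \<Rightarrow> complex \<Rightarrow> complex \<Rightarrow> nat \<Rightarrow>
    (nat \<Rightarrow> complex) \<Rightarrow> complex \<Rightarrow> (nat \<Rightarrow> real \<Rightarrow> complex) \<Rightarrow> (nat \<Rightarrow> complex \<Rightarrow> complex) \<Rightarrow>
    nat \<Rightarrow> complex \<Rightarrow> complex" where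
  "cactus_phi P Q a b k cs c \<gamma> B s z =
     (\<Sum>i=1..degree P. of_int (cactus_coeff P a b k cs c \<gamma> B s i) * poly Q (B i z))"

end

theory Submission
  imports Defs "HOL-Computational_Algebra.Fundamental_Theorem_Algebra"
begin

text \<open>For a primitive \<open>g\<close> of \<open>P' Q / (P - t)\<close>, telescoping along the path from \<open>a\<close> to \<open>b\<close> writes
  \<open>g b - g a\<close> as a signed sum over the edges of the cactus, which after the substitution \<open>u = P z\<close> is
  the sum over \<open>s\<close> of the Cauchy integrals \<open>\<integral> \<phi>\<^sub>s(u) / (u - t) du\<close> along \<open>\<gamma> s\<close>. The moments vanish
  iff this function of \<open>t\<close> vanishes near infinity. Since the star does not separate the plane, it then
  vanishes off the star, so it has no jump across \<open>\<gamma> s\<close>, and the jump is \<open>\<phi>\<^sub>s\<close>. The arcs are only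
  continuous, so the integrals are taken along nearby smooth paths, and the two sides of an arc are
  told apart by the winding number of a Jordan curve.

  The same argument shows that the cactus is a tree: a cycle would give coefficients \<open>f\<close> such that
  \<open>\<Sum>i. f s i * Q (B i z)\<close> vanishes for every polynomial \<open>Q\<close>, hence \<open>f = 0\<close> by interpolation, and
  counting vertices by Riemann-Hurwitz turns the independence of the edges into connectedness.

  Conversely, if all \<open>\<phi>\<^sub>s\<close> vanish, then for a primitive \<open>R\<close> of \<open>P\<^sup>m P' Q\<close> the signed sum of
  \<open>R \<circ> B i\<close> is constant along each arc, and telescoping gives \<open>R a = R b\<close>.\<close>

lemma homogeneous_system_nontrivial:
  fixes A :: "'i \<Rightarrow> 'j \<Rightarrow> 'a::field"
  assumes "finite J" "finite I" "card J < card I"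
  shows "\<exists>x. (\<exists>i\<in>I. x i \<noteq> 0) \<and> (\<forall>j\<in>J. (\<Sum>i\<in>I. x i * A i j) = 0)"
  using assms
proof (induction J arbitrary: I A rule: finite_induct)
  case empty
  then obtain i where "i \<in> I" by fastforce
  then show ?case by (intro exI[of _ "\<lambda>_. 1"]) auto
next
  case (insert j J)
  show ?case
  proof (cases "\<forall>i\<in>I. A i j = 0")
    case True
    from insert obtain x where "\<exists>i\<in>I. x i \<noteq> 0" "\<forall>j\<in>J. (\<Sum>i\<in>I. x i * A i j) = 0"
      by (metis Suc_lessD card_insert_disjoint)
    with True show ?thesis by (intro exI[of _ x]) auto
  next
    case False
    then obtain i0 where i0: "i0 \<in> I" "A i0 j \<noteq> 0" by blast
    define A' where "A' i j' = A i j' - A i j / A i0 j * A i0 j'" for i j'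
    have "card J < card (I - {i0})"
      using insert i0 by (simp add: card_insert_disjoint)
    then obtain x where x: "\<exists>i\<in>I - {i0}. x i \<noteq> 0" "\<forall>j\<in>J. (\<Sum>i\<in>I - {i0}. x i * A' i j) = 0"
      using insert.IH[of "I - {i0}" A'] insert.prems by auto
    define y where "y = x(i0 := - (\<Sum>i\<in>I - {i0}. x i * A i j) / A i0 j)"
    have split: "(\<Sum>i\<in>I. y i * A i j') = y i0 * A i0 j' + (\<Sum>i\<in>I - {i0}. x i * A i j')" for j'
    proof -
      have "(\<Sum>i\<in>I. y i * A i j') = y i0 * A i0 j' + (\<Sum>i\<in>I - {i0}. y i * A i j')"
        using i0 insert.prems by (simp add: sum.remove)
      also have "(\<Sum>i\<in>I - {i0}. y i * A i j') = (\<Sum>i\<in>I - {i0}. x i * A i j')"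
        by (rule sum.cong) (auto simp: y_def)
      finally show ?thesis .
    qed
    have "(\<Sum>i\<in>I. y i * A i j') = 0" if "j' \<in> insert j J" for j'
    proof (cases "j' = j")
      case True
      have "(\<Sum>i\<in>I. y i * A i j) = 0"
        using i0 by (simp only: split) (simp add: y_def)
      with True show ?thesis by simp
    next
      case False
      with that have "(\<Sum>i\<in>I - {i0}. x i * A' i j') = 0" using x(2) by blast
      also have "(\<Sum>i\<in>I - {i0}. x i * A' i j') =
          (\<Sum>i\<in>I - {i0}. x i * A i j') - (\<Sum>i\<in>I - {i0}. x i * A i j) / A i0 j * A i0 j'"
        by (simp add: A'_def right_diff_distrib sum_subtractf sum_distrib_right sum_divide_distrib mult.assoc)
      finally show ?thesis by (simp only: split) (simp add: y_def)
    qed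
    moreover have "\<exists>i\<in>I. y i \<noteq> 0" using x(1) by (auto simp: y_def)
    ultimately show ?thesis by blast
  qed
qed

lemma homotopic_polynomial_path:
  fixes g :: "real \<Rightarrow> 'a::euclidean_space"
  assumes "open S" "path g" "path_image g \<subseteq> S"
  obtains p where "polynomial_function p" "homotopic_paths S g p"
proof -
  obtain e where "e > 0" and e: "\<And>h. path h \<Longrightarrow> pathstart h = pathstart g \<Longrightarrow>
      pathfinish h = pathfinish g \<Longrightarrow> (\<forall>t\<in>{0..1}. norm (h t - g t) < e) \<Longrightarrow> homotopic_paths S g h"
    using homotopic_nearby_paths[OF assms(2,1,3)] by metis
  obtain p where "polynomial_function p" "pathstart p = pathstart g" "pathfinish p = pathfinish g"
      "\<And>t. t \<in> {0..1} \<Longrightarrow> norm (p t - g t) < e"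
    using path_approx_polynomial_function[OF assms(2) \<open>e > 0\<close>] by blast
  then show ?thesis using e that path_polynomial_function by blast
qed

lemma holomorphic_on_Cauchy_transform:
  assumes g: "polynomial_function g"
    and N: "continuous_on (path_image g) N" and p: "continuous_on (path_image g) p"
  shows "(\<lambda>t. contour_integral g (\<lambda>z. N z / (p z - t))) holomorphic_on - p ` path_image g"
proof -
  obtain g' where g': "polynomial_function g'" "\<And>x. (g has_vector_derivative g' x) (at x)"
    using has_vector_derivative_polynomial_function[OF g] by blast
  have vd: "vector_derivative g (at x) = g' x" for x
    using g'(2) vector_derivative_at by blast
  have cg: "continuous_on {0..1} g" "continuous_on {0..1} g'"
    using g g'(1) continuous_on_polymonial_function by blast+
  have cN: "continuous_on {0..1} (\<lambda>x. N (g x))" "continuous_on {0..1} (\<lambda>x. p (g x))"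
    using continuous_on_compose[OF cg(1)] N p by (simp_all add: path_image_def o_def)
  let ?O = "- p ` path_image g"
  have "compact (p ` path_image g)"
    by (intro compact_continuous_image p compact_path_image path_polynomial_function g)
  then have op: "open ?O" by (simp add: compact_imp_closed open_Compl)
  have "(\<lambda>t. contour_integral g (\<lambda>z. N z / (p z - t))) holomorphic_on V"
    if V: "convex V" "V \<subseteq> ?O" for V
  proof -
    have ne: "p (g x) - t \<noteq> 0" if "t \<in> V" "x \<in> {0..1}" for t x
      using that V(2) by (auto simp: path_image_def)
    have "(\<lambda>t. integral (cbox 0 1) (\<lambda>x. N (g x) / (p (g x) - t) * g' x)) holomorphic_on V"
    proof (rule leibniz_rule_holomorphic[where fx="\<lambda>t x. N (g x) / (p (g x) - t)\<^sup>2 * g' x"])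
      show "((\<lambda>t. N (g x) / (p (g x) - t) * g' x) has_field_derivative
            N (g x) / (p (g x) - t)\<^sup>2 * g' x) (at t within V)"
        if "t \<in> V" "x \<in> cbox 0 1" for t x
        using ne[of t x] that
        by (auto intro!: derivative_eq_intros simp: power2_eq_square)
      show "(\<lambda>x. N (g x) / (p (g x) - t) * g' x) integrable_on cbox 0 1" if "t \<in> V" for t
        using ne[OF that] cN cg
        by (intro integrable_continuous continuous_intros) auto
      show "continuous_on (V \<times> cbox 0 1) (\<lambda>(t, x). N (g x) / (p (g x) - t)\<^sup>2 * g' x)"
        unfolding split_beta
        using ne
        by (intro continuous_intros continuous_on_compose2[OF cN(1)] continuous_on_compose2[OF cN(2)]
            continuous_on_compose2[OF cg(2)]) auto
    qed (rule V)
    then show ?thesis by (simp add: contour_integral_integral vd)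
  qed
  then have "\<exists>e>0. (\<lambda>t. contour_integral g (\<lambda>z. N z / (p z - t))) holomorphic_on ball x e"
    if "x \<in> ?O" for x
    using op that by (metis convex_ball open_contains_ball)
  then have "(\<lambda>t. contour_integral g (\<lambda>z. N z / (p z - t))) field_differentiable (at x)" if "x \<in> ?O" for x
    using that by (meson holomorphic_on_imp_differentiable_at open_ball centre_in_ball)
  then show ?thesis
    unfolding holomorphic_on_def using field_differentiable_at_within by blast
qed

lemma AR_arc_image: "AR (path_image g)" if "arc g" for g :: "real \<Rightarrow> 'a::euclidean_space"
proof -
  have "path_image g homeomorphic {0..1::real}"
    using that by (simp add: homeomorphic_arc_image_interval)
  moreover have "AR {0..1::real}" by (intro convex_imp_AR) auto
  ultimately show ?thesis using homeomorphic_AR_iff_AR by blast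
qed

lemma connected_complement_Union_arcs:
  fixes \<gamma> :: "'i \<Rightarrow> real \<Rightarrow> 'a::euclidean_space"
  assumes "2 \<le> DIM('a)" "finite K"
    and "\<And>s. s \<in> K \<Longrightarrow> arc (\<gamma> s)" "\<And>s. s \<in> K \<Longrightarrow> c \<in> path_image (\<gamma> s)"
    and "\<And>s t. s \<in> K \<Longrightarrow> t \<in> K \<Longrightarrow> s \<noteq> t \<Longrightarrow> path_image (\<gamma> s) \<inter> path_image (\<gamma> t) = {c}"
  shows "connected (- (\<Union>s\<in>K. path_image (\<gamma> s)))"
proof (cases "K = {}")
  case False
  have "AR (\<Union>s\<in>K. path_image (\<gamma> s)) \<and> compact (\<Union>s\<in>K. path_image (\<gamma> s))"
    using assms(2) False assms(3-)
  proof (induction K rule: finite_ne_induct)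
    case (singleton s)
    then show ?case by (simp add: AR_arc_image compact_arc_image)
  next
    case (insert s K)
    have "path_image (\<gamma> s) \<inter> (\<Union>s\<in>K. path_image (\<gamma> s)) = {c}"
      using insert.hyps insert.prems(2,3) by fastforce
    moreover have "AR (path_image (\<gamma> s))" "compact (path_image (\<gamma> s))"
      using insert.prems(1) by (auto simp: AR_arc_image compact_arc_image)
    moreover have "AR (\<Union>s\<in>K. path_image (\<gamma> s)) \<and> compact (\<Union>s\<in>K. path_image (\<gamma> s))"
      by (rule insert.IH) (use insert.prems in auto)
    ultimately show ?case
      by (simp add: AR_closed_Un compact_imp_closed compact_Un AR_singleton)
  qed
  then show ?thesis using connected_complement_absolute_retract assms(1) by blast
qed (simp add: connected_UNIV)

lemma sum_order_eq_degree:
  fixes p :: "complex poly"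
  assumes "p \<noteq> 0"
  shows "(\<Sum>z | poly p z = 0. order z p) = degree p"
  using assms size_proots_complex[of p]
  by (simp add: size_multiset_overloaded_eq)

lemma card_preimage_critical_le:
  fixes P :: "complex poly"
  assumes "degree P > 0" "finite C" "critical_values P \<subseteq> C"
  shows "card {z. poly P z \<in> C} + degree P \<le> degree P * card C + 1"
proof -
  have ne: "P - [:c:] \<noteq> 0" for c
    using assms(1) by (metis degree_pCons_0 eq_iff_diff_eq_0 less_numeral_extra(3))
  have P': "pderiv P \<noteq> 0" using assms(1) by (simp add: pderiv_eq_0_iff)
  have deg: "degree (P - [:c:]) = degree P" for c
  proof -
    have "P - [:c:] = P + [:- c:]" by simp
    then show ?thesis using degree_add_eq_left[of "[:- c:]" P] assms(1) by (metis degree_pCons_0)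
  qed
  have fin: "finite {z. poly P z = c}" for c
    using poly_roots_finite[OF ne[of c]] by simp
  have "(\<Sum>z | poly P z = c. Suc (order z (pderiv P))) = degree P" for c
  proof -
    have "(\<Sum>z | poly P z = c. Suc (order z (pderiv P))) =
        (\<Sum>z | poly (P - [:c:]) z = 0. order z (P - [:c:]))"
      using ne by (intro sum.cong) (auto simp: order_pderiv pderiv_diff pderiv_pCons)
    then show ?thesis using sum_order_eq_degree[OF ne] deg by simp
  qed
  then have "degree P * card C = (\<Sum>c\<in>C. \<Sum>z | poly P z = c. Suc (order z (pderiv P)))"
    by simp
  also have "\<dots> = (\<Sum>z\<in>(\<Union>c\<in>C. {z. poly P z = c}). Suc (order z (pderiv P)))"
    using fin assms(2) by (intro sum.UNION_disjoint[symmetric]) auto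
  also have "(\<Union>c\<in>C. {z. poly P z = c}) = {z. poly P z \<in> C}" by auto
  finally have *: "degree P * card C =
      card {z. poly P z \<in> C} + (\<Sum>z | poly P z \<in> C. order z (pderiv P))"
    by (simp add: sum_Suc)
  have "finite {z. poly P z \<in> C}"
    using fin assms(2) by (auto simp: finite_UN \<open>(\<Union>c\<in>C. {z. poly P z = c}) = {z. poly P z \<in> C}\<close>[symmetric])
  then have "(\<Sum>z | poly (pderiv P) z = 0. order z (pderiv P)) \<le>
      (\<Sum>z | poly P z \<in> C. order z (pderiv P))"
    using assms(3) by (intro sum_mono2) (auto simp: critical_values_def)
  then have "degree P - 1 \<le> (\<Sum>z | poly P z \<in> C. order z (pderiv P))"
    using sum_order_eq_degree[OF P'] by (simp add: degree_pderiv)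
  with * assms(1) show ?thesis by simp
qed

lemma poly_lift_tendsto:
  fixes P :: "complex poly"
  assumes P: "degree P > 0" and f: "continuous_on {0..<1} f"
    and lim: "((\<lambda>x. poly P (f x)) \<longlongrightarrow> w) (at_left 1)"
  obtains v where "(f \<longlongrightarrow> v) (at_left (1::real))" "poly P v = w"
proof -
  have ne: "P - [:w:] \<noteq> 0"
    using P by (metis degree_pCons_0 eq_iff_diff_eq_0 less_numeral_extra(3))
  have fin: "finite {z. poly P z = w}"
    using poly_roots_finite[OF ne] by simp
  have ev: "\<exists>b\<in>{0<..<1}. \<forall>x\<in>{b<..<1}. dist (poly P (f x)) w < e" if e: "e > 0" for e
  proof -
    obtain b where b: "b < 1" "\<forall>y>b. y < 1 \<longrightarrow> dist (poly P (f y)) w < e"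
      using tendstoD[OF lim e] by (auto simp: eventually_at_left_field)
    then show ?thesis by (intro bexI[of _ "max b (1/2)"]) auto
  qed
  obtain M where M: "\<And>z. dist (poly P z) w < 1 \<Longrightarrow> norm z < M"
  proof -
    have "filterlim (poly P) at_infinity at_infinity"
      using P by (intro filterlim_poly_at_infinity) (auto)
    then have "\<forall>\<^sub>F z in at_infinity. norm (poly P z) \<ge> norm w + 1"
      using filterlim_at_infinity[of 0 "poly P" at_infinity]
      by (simp add: add_nonneg_pos)
    then obtain M where "\<And>z. norm z \<ge> M \<Longrightarrow> norm (poly P z) \<ge> norm w + 1"
      by (auto simp: eventually_at_infinity)
    then have "norm z < M" if "dist (poly P z) w < 1" for z
      using that norm_triangle_ineq2[of "poly P z" w] by (smt (verit) dist_norm)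
    then show ?thesis using that by blast
  qed
  obtain b0 where b0: "b0 \<in> {0<..<1}" "\<And>x. x \<in> {b0<..<1} \<Longrightarrow> norm (f x) < M"
    using ev[of 1] M by (auto simp: greaterThanLessThan_iff)
  define X where "X n = 1 - (1 - b0) / (real n + 2)" for n :: nat
  have X: "X n \<in> {b0<..<1}" for n
  proof -
    have "(1 - b0) * 1 < (1 - b0) * (real n + 2)"
      using b0(1) by (intro mult_strict_left_mono) auto
    then have "(1 - b0) / (real n + 2) < 1 - b0" by (simp add: divide_less_eq)
    moreover have "(1 - b0) / (real n + 2) > 0" using b0(1) by simp
    ultimately show ?thesis by (simp add: X_def)
  qed
  have Xlim: "X \<longlonglongrightarrow> 1"
  proof -
    have "(\<lambda>n. (1 - b0) / real (Suc (Suc n))) \<longlonglongrightarrow> 0"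
      using LIMSEQ_Suc[OF LIMSEQ_Suc[OF lim_const_over_n]] .
    then have "(\<lambda>n. 1 - (1 - b0) / real (Suc (Suc n))) \<longlonglongrightarrow> 1 - 0"
      by (intro tendsto_diff tendsto_const)
    then show ?thesis unfolding X_def by (simp add: add.commute)
  qed
  have "bounded (range (f \<circ> X))"
    unfolding bounded_iff using b0(2)[OF X] by (auto intro!: exI[of _ M] less_imp_le)
  then obtain v r where r: "strict_mono r" "((f \<circ> X) \<circ> r) \<longlonglongrightarrow> v"
    using bounded_imp_convergent_subsequence by blast
  have Xr: "(X \<circ> r) \<longlonglongrightarrow> 1" using LIMSEQ_subseq_LIMSEQ[OF Xlim r(1)] .
  have XrF: "filterlim (X \<circ> r) (at_left 1) sequentially"
  proof -
    have "(X \<circ> r) n \<in> {..<1} \<and> (X \<circ> r) n \<noteq> 1" for n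
      using X[of "r n"] by auto
    then show ?thesis using Xr by (auto simp: filterlim_at)
  qed
  have "(\<lambda>n. poly P (f ((X \<circ> r) n))) \<longlonglongrightarrow> w"
    using filterlim_compose[OF lim XrF] .
  moreover have "(\<lambda>n. poly P (f ((X \<circ> r) n))) \<longlonglongrightarrow> poly P v"
    using r(2) by (intro tendsto_intros) (simp add: o_def)
  ultimately have Pv: "poly P v = w" using LIMSEQ_unique by blast
  have "(f \<longlongrightarrow> v) (at_left 1)"
  proof (rule tendstoI)
    fix e :: real assume "e > 0"
    obtain e' where e': "e' > 0" "e' \<le> e" "\<forall>z. poly P z = w \<longrightarrow> z \<noteq> v \<longrightarrow> e' < dist v z"
    proof -
      obtain d where "d > 0" "\<forall>z\<in>{z. poly P z = w}. z \<noteq> v \<longrightarrow> d \<le> dist v z"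
        using finite_set_avoid[OF fin] by blast
      then show ?thesis using that[of "min e (d/2)"] \<open>e > 0\<close> by fastforce
    qed
    have "compact ((\<lambda>z. poly P z) ` sphere v e')"
      by (intro compact_continuous_image continuous_intros compact_sphere)
    moreover have "w \<notin> poly P ` sphere v e'" using e' by auto
    ultimately obtain d where d: "d > 0" "\<And>z. z \<in> sphere v e' \<Longrightarrow> d \<le> dist w (poly P z)"
      using separate_point_closed[OF compact_imp_closed, of "poly P ` sphere v e'" w] by auto
    obtain b where b: "b\<in>{0<..<1}" "\<And>x. x\<in>{b<..<1} \<Longrightarrow> dist (poly P (f x)) w < d"
      using ev[OF d(1)] by blast
    have con: "connected (f ` {b<..<1})"
      using b(1) by (intro connected_continuous_image continuous_on_subset[OF f]) auto
    have "f ` {b<..<1} \<inter> frontier (ball v e') = {}"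
      using e'(1) b(2) d(2) by (force simp: dist_commute)
    moreover have "f ` {b<..<1} \<inter> ball v e' \<noteq> {}"
    proof -
      have "\<forall>\<^sub>F n in sequentially. X (r n) > b"
        using order_tendstoD(1)[OF Xr, of b] b(1) by (simp add: o_def)
      moreover have "\<forall>\<^sub>F n in sequentially. dist (f (X (r n))) v < e'"
        using tendstoD[OF r(2) e'(1)] by (simp add: o_def)
      ultimately have "\<forall>\<^sub>F n in sequentially. X (r n) > b \<and> dist (f (X (r n))) v < e'"
        by (rule eventually_conj)
      then obtain n where "X (r n) > b" "dist (f (X (r n))) v < e'"
        using eventually_happens' sequentially_bot by blast
      then have "f (X (r n)) \<in> f ` {b<..<1} \<inter> ball v e'"
        using X[of "r n"] by (simp add: dist_commute)
      then show ?thesis by blast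
    qed
    ultimately have sub: "f ` {b<..<1} \<subseteq> ball v e'"
      using connected_Int_frontier[OF con, of "ball v e'"] by blast
    then show "\<forall>\<^sub>F x in at_left 1. dist (f x) v < e"
      unfolding eventually_at_left_field
    proof (intro exI[of _ b] conjI allI impI)
      fix y assume "b < y" "y < 1"
      then have "f y \<in> ball v e'" using sub by (meson greaterThanLessThan_iff image_eqI subsetD)
      then show "dist (f y) v < e" using e'(2) by (simp add: dist_commute)
    qed (use b(1) in auto)
  qed
  with Pv that show ?thesis by blast
qed

lemma last_exit_point:
  fixes d :: "real \<Rightarrow> real"
  assumes d: "continuous_on {a..b} d" and "a \<le> b" "R \<le> d a" "d b < R"
  obtains x where "a \<le> x" "x < b" "d x = R" "\<And>y. x < y \<Longrightarrow> y \<le> b \<Longrightarrow> d y < R"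
proof -
  define X where "X = {y \<in> {a..b}. R \<le> d y}"
  have "closed X" unfolding X_def
    by (intro closed_Collect_le continuous_closed_preimage_constant continuous_on_closed_Collect_le
        continuous_intros d closed_atLeastAtMost)
  moreover have "X \<subseteq> {a..b}" by (auto simp: X_def)
  ultimately have "compact X" using compact_Int_closed[of "{a..b}" X] by (simp add: Int_absorb1)
  moreover have "X \<noteq> {}" using assms by (auto simp: X_def)
  ultimately obtain x where x: "x \<in> X" "\<And>y. y \<in> X \<Longrightarrow> y \<le> x"
    using compact_attains_sup by metis
  have xab: "a \<le> x" "x < b" "R \<le> d x"
    using x(1) assms(4) by (auto simp: X_def le_less)
  have "continuous_on {x..b} d" using d xab by (auto intro: continuous_on_subset)
  then obtain z where "x \<le> z" "z \<le> b" "d z = R"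
    using IVT2'[of d b R x] xab assms(4) by auto
  then have "d x = R" using x(2)[of z] xab by (auto simp: X_def)
  moreover have "d y < R" if "x < y" "y \<le> b" for y
    using x(2)[of y] that xab by (force simp: X_def)
  ultimately show ?thesis using that xab by blast
qed

lemma arc_closed_up_in_disc:
  fixes g :: "real \<Rightarrow> complex"
  assumes g: "arc g" and x0: "0 < x0" "x0 < 1" and R: "0 < R"
    and far: "R \<le> dist (g x0) (g 0)" "R \<le> dist (g x0) (g 1)"
  obtains x1 x2 h where "0 \<le> x1" "x1 < x0" "x0 < x2" "x2 \<le> 1"
    "g ` {x1..x2} \<subseteq> cball (g x0) R" "path h" "path_image h \<subseteq> sphere (g x0) R"
    "pathstart h = g x2" "pathfinish h = g x1" "simple_path (subpath x1 x2 g +++ h)"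
proof -
  have cg: "continuous_on {0..1} g" using g by (simp add: arc_def path_def)
  define d where "d y = dist (g x0) (g y)" for y
  have cd: "continuous_on {0..1} d" unfolding d_def by (intro continuous_intros cg)
  have d0: "d x0 < R" using R by (simp add: d_def)
  obtain x1 where x1: "0 \<le> x1" "x1 < x0" "d x1 = R" "\<And>y. x1 < y \<Longrightarrow> y \<le> x0 \<Longrightarrow> d y < R"
  proof -
    have "continuous_on {0..x0} d" "0 \<le> x0" "R \<le> d 0"
      using cd far(1) x0 by (auto simp: d_def intro: continuous_on_subset)
    from last_exit_point[OF this d0] show ?thesis using that by blast
  qed
  have "continuous_on {-1..-x0} (\<lambda>y. d (- y))"
    by (rule continuous_on_compose2[OF cd]) (use x0 in \<open>auto intro!: continuous_intros\<close>)
  then obtain x2' where x2': "-1 \<le> x2'" "x2' < -x0" "d (-x2') = R" "\<And>y. x2' < y \<Longrightarrow> y \<le> -x0 \<Longrightarrow> d (-y) < R"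
  proof -
    assume cont: "continuous_on {-1..-x0} (\<lambda>y. d (- y))"
    have "-1 \<le> -x0" "R \<le> d (- (-1))" "d (- (- x0)) < R"
      using d0 far(2) x0 by (auto simp: d_def)
    from last_exit_point[OF cont this] show ?thesis using that by blast
  qed
  define x2 where "x2 = - x2'"
  have x2: "x0 < x2" "x2 \<le> 1" "d x2 = R" "\<And>y. x0 \<le> y \<Longrightarrow> y < x2 \<Longrightarrow> d y < R"
    using x2'(1-3) x2'(4)[of "- _"] by (auto simp: x2_def)
  have dlt: "d y < R" if "x1 < y" "y < x2" for y
    using x1(4) x2(4) that by (cases "y \<le> x0") auto
  have inj: "inj_on g {0..1}" using g by (simp add: arc_def)
  have gne: "g x1 \<noteq> g x2"
    using inj_onD[OF inj, of x1 x2] x0 x1 x2 by auto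
  define \<theta>1 where "\<theta>1 = Arg (g x1 - g x0)"
  define \<theta>2 where "\<theta>2 = Arg (g x2 - g x0)"
  have polar: "g x1 = g x0 + R * exp (\<i> * \<theta>1)" "g x2 = g x0 + R * exp (\<i> * \<theta>2)"
  proof -
    have "z = w + R * exp (\<i> * Arg (z - w))" if "dist w z = R" for z w :: complex
      using Arg_eq[of "z - w"] that R by (auto simp: dist_norm norm_minus_commute)
    then show "g x1 = g x0 + R * exp (\<i> * \<theta>1)" "g x2 = g x0 + R * exp (\<i> * \<theta>2)"
      using x1(3) x2(3) unfolding \<theta>1_def \<theta>2_def d_def by blast+
  qed
  define h where "h = part_circlepath (g x0) R \<theta>2 \<theta>1"
  have \<theta>: "\<theta>2 \<noteq> \<theta>1" "\<bar>\<theta>2 - \<theta>1\<bar> < 2 * pi"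
  proof -
    show "\<theta>2 \<noteq> \<theta>1" using gne polar by metis
    have "-pi < \<theta>1" "\<theta>1 \<le> pi" "-pi < \<theta>2" "\<theta>2 \<le> pi"
      unfolding \<theta>1_def \<theta>2_def using Arg_bounded by blast+
    then show "\<bar>\<theta>2 - \<theta>1\<bar> < 2 * pi" by arith
  qed
  have h: "arc h" "path_image h \<subseteq> sphere (g x0) R" "pathstart h = g x2" "pathfinish h = g x1"
  proof -
    show "arc h" unfolding h_def using R \<theta> by (intro arc_part_circlepath) auto
    show "path_image h \<subseteq> sphere (g x0) R"
      unfolding h_def using R by (intro path_image_part_circlepath_subset') auto
    show "pathstart h = g x2" "pathfinish h = g x1"
      using polar by (simp_all add: h_def)
  qed
  have img: "path_image (subpath x1 x2 g) = g ` {x1..x2}"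
    using x1 x2 by (simp add: path_image_subpath)
  have "simple_path (subpath x1 x2 g +++ h)"
  proof (rule simple_path_join_loop)
    show "arc (subpath x1 x2 g)"
      using g x0 x1 x2 by (intro arc_subpath_arc) auto
    show "path_image (subpath x1 x2 g) \<inter> path_image h \<subseteq> {pathstart (subpath x1 x2 g), pathstart h}"
    proof
      fix z assume z: "z \<in> path_image (subpath x1 x2 g) \<inter> path_image h"
      then obtain y where y: "y \<in> {x1..x2}" "z = g y" by (auto simp: img)
      moreover have "d y = R" using z h(2) y by (auto simp: d_def)
      ultimately have "y = x1 \<or> y = x2" using dlt[of y] by force
      then show "z \<in> {pathstart (subpath x1 x2 g), pathstart h}" using y h(3) by auto
    qed
  qed (use h in auto)
  moreover have "g ` {x1..x2} \<subseteq> cball (g x0) R"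
    using dlt x1(3) x2(3) by (force simp: d_def le_less)
  ultimately show ?thesis using that[of x1 x2 h] x1 x2 h arc_imp_path by blast
qed

lemma simple_loop_winding_number_jump:
  assumes c: "simple_path c" "pathfinish c = pathstart c" and u: "u \<in> path_image c" and r: "r > 0"
  obtains s t where "s \<in> ball u r - path_image c" "t \<in> ball u r - path_image c"
    "winding_number c s = 0" "winding_number c t \<noteq> 0"
proof -
  note J = Jordan_inside_outside[OF c]
  have "u \<in> closure (inside (path_image c))" "u \<in> closure (outside (path_image c))"
    using J u by (metis DiffD1 frontier_def)+
  then obtain s t where st: "s \<in> outside (path_image c)" "dist s u < r"
      "t \<in> inside (path_image c)" "dist t u < r"
    using r by (meson closure_approachable)
  have "winding_number c t \<noteq> 0"
    using simple_closed_path_norm_winding_number_inside[OF c(1) st(3)] by auto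
  moreover have "winding_number c s = 0"
    using winding_number_zero_in_outside[OF simple_path_imp_path[OF c(1)] c(2) st(1)] .
  moreover have "s \<notin> path_image c" "t \<notin> path_image c"
    using st(1,3) inside_no_overlap outside_no_overlap by blast+
  ultimately show ?thesis using st that by (auto simp: dist_commute)
qed

section \<open>The lifted star\<close>

locale star_preimage =
  fixes P :: "complex poly" and a b c :: complex and k :: nat and cs :: "nat \<Rightarrow> complex"
    and \<gamma> :: "nat \<Rightarrow> real \<Rightarrow> complex" and U :: "complex set" and B :: "nat \<Rightarrow> complex \<Rightarrow> complex"
  assumes degree_pos: "degree P > 0"
    and colors: "cactus_colors P a b k cs"
    and star: "star_arcs k cs c \<gamma>"
    and domain: "star_domain P k cs \<gamma> U"
    and branches: "inverse_branches P U B"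
begin

lemma color_image: "cs ` {1..k} = critical_values P \<union> {poly P a, poly P b}"
  and cs_inj: "inj_on cs {1..k}"
  using colors by (auto simp: cactus_colors_def bij_betw_def)

lemma arc_\<gamma>: "s \<in> {1..k} \<Longrightarrow> arc (\<gamma> s)"
  and \<gamma>_0: "s \<in> {1..k} \<Longrightarrow> \<gamma> s 0 = c"
  and \<gamma>_1: "s \<in> {1..k} \<Longrightarrow> \<gamma> s 1 = cs s"
  and \<gamma>_Int: "s \<in> {1..k} \<Longrightarrow> t \<in> {1..k} \<Longrightarrow> s \<noteq> t \<Longrightarrow>
    path_image (\<gamma> s) \<inter> path_image (\<gamma> t) = {c}"
  and center_not_color: "c \<notin> cs ` {1..k}"
  using star by (auto simp: star_arcs_def pathstart_def pathfinish_def)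

lemma open_U: "open U" and simply_connected_U: "simply_connected U" and connected_U: "connected U"
  and star_subset_U: "star_set k \<gamma> - cs ` {1..k} \<subseteq> U"
  using domain by (auto simp: star_domain_def simply_connected_imp_connected)

lemma holomorphic_B: "i \<in> {1..degree P} \<Longrightarrow> B i holomorphic_on U"
  and B_bij: "z \<in> U \<Longrightarrow> bij_betw (\<lambda>i. B i z) {1..degree P} {w. poly P w = z}"
  using branches by (auto simp: inverse_branches_def)

lemma poly_B: "i \<in> {1..degree P} \<Longrightarrow> z \<in> U \<Longrightarrow> poly P (B i z) = z"
  using bij_betwE[OF B_bij] by blast

lemma B_inj: "i \<in> {1..degree P} \<Longrightarrow> j \<in> {1..degree P} \<Longrightarrow> z \<in> U \<Longrightarrow> B i z = B j z \<Longrightarrow> i = j"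
  using B_bij[of z] by (auto simp: bij_betw_def dest: inj_onD)

lemma B_surj:
  assumes "poly P w \<in> U"
  obtains i where "i \<in> {1..degree P}" "w = B i (poly P w)"
  using B_bij[OF assms] by (force simp: bij_betw_def)

lemma continuous_\<gamma>: "s \<in> {1..k} \<Longrightarrow> continuous_on {0..1} (\<gamma> s)"
  using arc_\<gamma> by (simp add: arc_def path_def)

lemma \<gamma>_in_star:
  assumes s: "s \<in> {1..k}" and x: "0 \<le> x" "x < 1"
  shows "\<gamma> s x \<in> star_set k \<gamma> - cs ` {1..k}"
proof -
  have "\<gamma> s x \<noteq> cs t" if t: "t \<in> {1..k}" for t
  proof (cases "t = s")
    case True
    have "inj_on (\<gamma> s) {0..1}" using arc_\<gamma>[OF s] by (simp add: arc_def)
    then have "\<gamma> s x \<noteq> \<gamma> s 1" using x inj_onD[of "\<gamma> s" "{0..1}" x 1] by auto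
    then show ?thesis using True \<gamma>_1[OF s] by simp
  next
    case False
    have "\<gamma> s x \<in> path_image (\<gamma> s)" "cs t \<in> path_image (\<gamma> t)"
      using x \<gamma>_1[OF t] pathfinish_in_path_image[of "\<gamma> t"]
      by (auto simp: path_image_def pathfinish_def)
    then show ?thesis
      using \<gamma>_Int[OF s t] False t center_not_color by fastforce
  qed
  then show ?thesis using s x by (fastforce simp: star_set_def path_image_def)
qed

lemma \<gamma>_in_U: "s \<in> {1..k} \<Longrightarrow> 0 \<le> x \<Longrightarrow> x < 1 \<Longrightarrow> \<gamma> s x \<in> U"
  using \<gamma>_in_star star_subset_U by blast

lemma color_exists: "z \<in> critical_values P \<union> {poly P a, poly P b} \<Longrightarrow> \<exists>s\<in>{1..k}. z = cs s"
  using color_image by blast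

lemma center_in_U: "c \<in> U"
proof -
  obtain s where "s \<in> {1..k}" using color_exists[of "poly P a"] by auto
  then show ?thesis using \<gamma>_in_U[of s 0] \<gamma>_0 by simp
qed

lemma B_has_derivative:
  assumes i: "i \<in> {1..degree P}" and z: "z \<in> U"
  obtains D where "(B i has_field_derivative D) (at z)" "poly (pderiv P) (B i z) * D = 1"
proof -
  obtain D where D: "(B i has_field_derivative D) (at z)"
    using holomorphic_on_imp_differentiable_at[OF holomorphic_B[OF i] open_U z]
    by (auto simp: field_differentiable_def)
  have "((\<lambda>z. poly P (B i z)) has_field_derivative poly (pderiv P) (B i z) * D) (at z)"
    using DERIV_chain2[OF poly_DERIV D] .
  moreover have "((\<lambda>z. poly P (B i z)) has_field_derivative 1) (at z)"
    by (rule has_field_derivative_transform_within_open[OF DERIV_ident open_U z])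
      (use poly_B[OF i] in auto)
  ultimately show ?thesis using that D DERIV_unique by blast
qed

lemma continuous_B_\<gamma>:
  assumes "s \<in> {1..k}" "i \<in> {1..degree P}"
  shows "continuous_on {0..<1} (\<lambda>x. B i (\<gamma> s x))"
proof (rule continuous_on_compose2[of U "B i" "{0..<1}" "\<gamma> s"])
  show "continuous_on U (B i)" using assms holomorphic_B holomorphic_on_imp_continuous_on by blast
  show "continuous_on {0..<1} (\<gamma> s)"
    by (rule continuous_on_subset[OF continuous_\<gamma>]) (use assms in auto)
qed (use assms \<gamma>_in_U in auto)

definition endpoint :: "nat \<Rightarrow> nat \<Rightarrow> complex" where
  "endpoint s i = Lim (at_left 1) (\<lambda>x. B i (\<gamma> s x))"

lemma
  assumes s: "s \<in> {1..k}" and i: "i \<in> {1..degree P}"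
  shows B_\<gamma>_tendsto: "((\<lambda>x. B i (\<gamma> s x)) \<longlongrightarrow> endpoint s i) (at_left 1)"
    and poly_endpoint: "poly P (endpoint s i) = cs s"
proof -
  have "(\<gamma> s \<longlongrightarrow> cs s) (at_left 1)"
    using continuous_\<gamma>[OF s] \<gamma>_1[OF s] continuous_on_Icc_at_leftD by fastforce
  moreover have "\<forall>\<^sub>F x in at_left 1. poly P (B i (\<gamma> s x)) = \<gamma> s x"
    unfolding eventually_at_left_field
    using poly_B[OF i \<gamma>_in_U[OF s]] by (intro exI[of _ 0]) auto
  ultimately have "((\<lambda>x. poly P (B i (\<gamma> s x))) \<longlongrightarrow> cs s) (at_left 1)"
    by (simp add: tendsto_cong)
  then obtain v where v: "((\<lambda>x. B i (\<gamma> s x)) \<longlongrightarrow> v) (at_left 1)" "poly P v = cs s"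
    using poly_lift_tendsto[OF degree_pos continuous_B_\<gamma>[OF s i]] by blast
  then have "endpoint s i = v"
    unfolding endpoint_def by (intro tendsto_Lim) auto
  with v show "((\<lambda>x. B i (\<gamma> s x)) \<longlongrightarrow> endpoint s i) (at_left 1)" "poly P (endpoint s i) = cs s"
    by auto
qed

definition edge :: "nat \<Rightarrow> nat \<Rightarrow> real \<Rightarrow> complex" where
  "edge s i x = (if x < 1 then B i (\<gamma> s x) else endpoint s i)"

lemma edge_0: "s \<in> {1..k} \<Longrightarrow> edge s i 0 = B i c" and edge_1: "edge s i 1 = endpoint s i"
  by (simp_all add: edge_def \<gamma>_0)

lemma path_edge:
  assumes s: "s \<in> {1..k}" and i: "i \<in> {1..degree P}"
  shows "path (edge s i)"
proof -
  let ?f = "\<lambda>x. B i (\<gamma> s x)"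
  have cont: "continuous_on {0..1/2} ?f" "continuous_on {0<..<1} ?f"
    by (rule continuous_on_subset[OF continuous_B_\<gamma>[OF s i]]; auto)+
  have eq: "\<forall>\<^sub>F x in F. edge s i x = ?f x" if "\<forall>\<^sub>F x in F. x < 1" for F
    using that by (rule eventually_mono) (simp add: edge_def)
  have "continuous_on {0..1} (edge s i)"
  proof (rule continuous_on_IccI)
    have "(?f \<longlongrightarrow> ?f 0) (at_right 0)"
      using continuous_on_Icc_at_rightD[OF cont(1)] by simp
    moreover have "\<forall>\<^sub>F x in at_right 0. x < (1::real)"
      unfolding eventually_at_right_field by (intro exI[of _ 1]) auto
    ultimately show "(edge s i \<longlongrightarrow> edge s i 0) (at_right 0)"
      by (simp add: tendsto_cong[OF eq] edge_0[OF s] \<gamma>_0[OF s])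
    have "\<forall>\<^sub>F x in at_left 1. x < (1::real)"
      by (simp add: eventually_at_filter)
    then show "(edge s i \<longlongrightarrow> edge s i 1) (at_left 1)"
      by (simp add: B_\<gamma>_tendsto[OF s i] tendsto_cong[OF eq] edge_1)
    show "edge s i \<midarrow>x\<rightarrow> edge s i x" if x: "0 < x" "x < 1" for x
    proof -
      have "?f \<midarrow>x\<rightarrow> ?f x"
        using cont(2) x by (simp add: continuous_on_eq_continuous_at isCont_def)
      moreover have "\<forall>\<^sub>F y in at x. y < 1"
        using x by (intro order_tendstoD(2)[OF tendsto_ident_at])
      ultimately show ?thesis
        using x by (simp add: tendsto_cong[OF eq] edge_def[of s i x])
    qed
  qed auto
  then show ?thesis by (simp add: path_def)
qed

lemma poly_edge:
  assumes "s \<in> {1..k}" "i \<in> {1..degree P}" "x \<in> {0..1}"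
  shows "poly P (edge s i x) = \<gamma> s x"
  using assms poly_B[of i "\<gamma> s x"] \<gamma>_in_U[of s x] poly_endpoint \<gamma>_1
  by (cases "x < 1") (auto simp: edge_def)

lemma edge_in_lifts: "s \<in> {1..k} \<Longrightarrow> i \<in> {1..degree P} \<Longrightarrow> edge s i \<in> lifts P (\<gamma> s)"
  using path_edge poly_edge by (simp add: lifts_def)

lemma lift_is_edge:
  assumes s: "s \<in> {1..k}" and h: "h \<in> lifts P (\<gamma> s)"
  obtains i where "i \<in> {1..degree P}" "\<And>x. x \<in> {0..1} \<Longrightarrow> h x = edge s i x"
proof -
  have ch: "continuous_on {0..1} h" and Ph: "\<And>t. t \<in> {0..1} \<Longrightarrow> poly P (h t) = \<gamma> s t"
    using h by (auto simp: lifts_def path_def)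
  define X where "X j = {t \<in> {0..<1}. h t - B j (\<gamma> s t) = 0}" for j
  have clo: "closedin (top_of_set {0..<1}) (X j)" if "j \<in> {1..degree P}" for j
    unfolding X_def
    by (intro continuous_closedin_preimage_constant continuous_on_diff continuous_B_\<gamma> s that
        continuous_on_subset[OF ch]) auto
  have cover: "\<exists>j\<in>{1..degree P}. t \<in> X j" if "t \<in> {0..<1}" for t
  proof -
    have "poly P (h t) \<in> U" using Ph \<gamma>_in_U[OF s] that by auto
    then obtain j where "j \<in> {1..degree P}" "h t = B j (poly P (h t))" using B_surj by metis
    then show ?thesis using that Ph[of t] by (auto simp: X_def intro!: bexI[of _ j])
  qed
  have disj: "X i \<inter> X j = {}" if "i \<in> {1..degree P}" "j \<in> {1..degree P}" "i \<noteq> j" for i j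
    using that B_inj[of i j] \<gamma>_in_U[OF s] by (fastforce simp: X_def)
  obtain i where i: "i \<in> {1..degree P}" "0 \<in> X i" using cover[of 0] by auto
  have "{0..<1} - X i = (\<Union>j\<in>{1..degree P} - {i}. X j)"
    using cover disj[of i] i(1) by (fastforce simp: X_def)
  moreover have "closedin (top_of_set {0..<1}) (\<Union>j\<in>{1..degree P} - {i}. X j)"
    using clo by (intro closedin_Union) auto
  ultimately have "closedin (top_of_set {0..<1}) ({0..<1} - X i)" by simp
  moreover have "X i \<subseteq> {0..<1}" by (auto simp: X_def)
  ultimately have "openin (top_of_set {0..<1}) (X i)"
    by (simp add: openin_closedin_eq)
  then have "X i = {0..<1}"
    using clo[OF i(1)] i(2) connected_clopen[of "{0..<1::real}"] by auto
  then have "x \<in> X i" if "x \<in> {0..<1}" for x using that by simp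
  then have eq: "h x = B i (\<gamma> s x)" if "x \<in> {0..<1}" for x
    using that by (fastforce simp: X_def)
  have "(h \<longlongrightarrow> h 1) (at_left 1)"
    using continuous_on_Icc_at_leftD[OF ch] by simp
  moreover have "\<forall>\<^sub>F x in at_left 1. h x = B i (\<gamma> s x)"
    unfolding eventually_at_left_field using eq by (intro exI[of _ 0]) auto
  ultimately have "((\<lambda>x. B i (\<gamma> s x)) \<longlongrightarrow> h 1) (at_left 1)"
    by (simp add: tendsto_cong)
  then have "h 1 = endpoint s i"
    using B_\<gamma>_tendsto[OF s i(1)] tendsto_unique trivial_limit_at_left_real by blast
  then have "h x = edge s i x" if "x \<in> {0..1}" for x
    using that eq[of x] by (cases "x < 1") (auto simp: edge_def)
  then show ?thesis using that i(1) by blast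
qed

abbreviation G where "G \<equiv> extended_cactus P k cs c \<gamma>"

abbreviation edge_out where "edge_out s i \<equiv> (B i c, path_image (edge s i), endpoint s i)"
abbreviation edge_in where "edge_in s i \<equiv> (endpoint s i, path_image (edge s i), B i c)"

lemma verts_G: "verts G = {z. poly P z \<in> insert c (cs ` {1..k})}"
  by (simp add: extended_cactus_def)

lemma tail_G [simp]: "tail G (u, e, v) = u" and head_G [simp]: "head G (u, e, v) = v"
  by (simp_all add: extended_cactus_def)

lemma arcs_G: "arcs G = (\<Union>s\<in>{1..k}. \<Union>i\<in>{1..degree P}. {edge_out s i, edge_in s i})"
proof -
  let ?E = "\<lambda>h. {(pathstart h, path_image h, pathfinish h), (pathfinish h, path_image h, pathstart h)}"
  have cong: "?E h = ?E h'" if "\<And>x. x \<in> {0..1} \<Longrightarrow> h x = h' x" for h h' :: "real \<Rightarrow> complex"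
    using that by (simp add: pathstart_def pathfinish_def path_image_def)
  have E: "?E (edge s i) = {edge_out s i, edge_in s i}" if "s \<in> {1..k}" for s i
    using that by (simp add: pathstart_def pathfinish_def edge_0 edge_1)
  have "(\<Union>h\<in>lifts P (\<gamma> s). ?E h) = (\<Union>i\<in>{1..degree P}. ?E (edge s i))" if s: "s \<in> {1..k}" for s
  proof (intro subset_antisym UN_least)
    fix h assume "h \<in> lifts P (\<gamma> s)"
    then obtain i where "i \<in> {1..degree P}" "\<And>x. x \<in> {0..1} \<Longrightarrow> h x = edge s i x"
      using lift_is_edge[OF s] by blast
    then show "?E h \<subseteq> (\<Union>i\<in>{1..degree P}. ?E (edge s i))" using cong[of h "edge s i"] by blast
  qed (use edge_in_lifts[OF s] in blast)
  then show ?thesis using E by (simp add: extended_cactus_def)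
qed

lemma wf_G: "wf_digraph G"
proof
  fix e assume "e \<in> arcs G"
  then obtain s i where "s \<in> {1..k}" "i \<in> {1..degree P}" "e = edge_out s i \<or> e = edge_in s i"
    by (auto simp: arcs_G)
  then show "tail G e \<in> verts G" "head G e \<in> verts G"
    using poly_endpoint[of s i] poly_B[of i c] center_in_U by (auto simp: verts_G)
qed

lemma edge_subset_star:
  assumes s: "s \<in> {1..k}" and i: "i \<in> {1..degree P}"
  shows "path_image (edge s i) \<subseteq> cactus_star k cs \<gamma> B i"
proof
  let ?S = "B i ` (star_set k \<gamma> - cs ` {1..k})"
  fix z assume "z \<in> path_image (edge s i)"
  then obtain x where x: "0 \<le> x" "x \<le> 1" "z = edge s i x" by (auto simp: path_image_def)
  show "z \<in> cactus_star k cs \<gamma> B i"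
  proof (cases "x < 1")
    case True
    then have "z \<in> ?S" using x \<gamma>_in_star[OF s] by (auto simp: edge_def)
    then show ?thesis using closure_subset[of ?S] by (auto simp: cactus_star_def)
  next
    case False
    then have z: "z = endpoint s i" using x by (simp add: edge_def)
    have "\<forall>\<^sub>F x in at_left 1. B i (\<gamma> s x) \<in> closure ?S"
      unfolding eventually_at_left_field
    proof (intro exI[of _ 0] conjI allI impI)
      fix y :: real assume "0 < y" "y < 1"
      then have "B i (\<gamma> s y) \<in> ?S" using \<gamma>_in_star[OF s, of y] by auto
      then show "B i (\<gamma> s y) \<in> closure ?S" by (rule subsetD[OF closure_subset])
    qed simp
    then have "endpoint s i \<in> closure ?S"
      using B_\<gamma>_tendsto[OF s i] by (intro Lim_in_closed_set[OF closed_closure]) auto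
    then show ?thesis using z by (simp add: cactus_star_def)
  qed
qed

lemma edge_eq_iff:
  assumes "s \<in> {1..k}" "i \<in> {1..degree P}" "t \<in> {1..k}" "j \<in> {1..degree P}"
  shows "edge_out s i = edge_out t j \<longleftrightarrow> s = t \<and> i = j"
    and "edge_in s i = edge_in t j \<longleftrightarrow> s = t \<and> i = j"
    and "edge_out s i \<noteq> edge_in t j"
proof -
  have "endpoint s i = endpoint t j \<Longrightarrow> s = t"
    using poly_endpoint assms cs_inj by (metis inj_onD)
  moreover have "B i c = B j c \<Longrightarrow> i = j" using B_inj assms center_in_U by blast
  moreover have "B i c \<noteq> endpoint t j"
    using poly_endpoint poly_B center_in_U assms center_not_color by (metis imageI)
  ultimately show "edge_out s i = edge_out t j \<longleftrightarrow> s = t \<and> i = j"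
    "edge_in s i = edge_in t j \<longleftrightarrow> s = t \<and> i = j" "edge_out s i \<noteq> edge_in t j" by auto
qed

end

section \<open>Vanishing of the branch sums\<close>

text \<open>A Sokhotski-Plemelj argument that needs no smoothness of the arc: where the winding number of
  the closed curve changes, \<open>E - \<integral>\<^bsub>\<eta>\<^esub>\<close> differs from zero by a multiple of the density, but it is
  holomorphic across.\<close>

lemma density_zero_if_no_jump:
  assumes U: "open U" "simply_connected U" and \<phi>: "\<phi> holomorphic_on U"
    and uU: "ball u r \<subseteq> U"
    and \<beta>: "valid_path \<beta>" "path_image \<beta> \<subseteq> U"
    and \<eta>: "polynomial_function \<eta>" "path_image \<eta> \<subseteq> U - ball u r"
    and loop: "pathfinish \<beta> = pathstart \<eta>" "pathfinish \<eta> = pathstart \<beta>"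
    and E: "E holomorphic_on ball u r"
    and C: "open C" "C \<inter> path_image \<beta> = {}"
    and zero: "\<And>t. t \<in> C \<inter> ball u r \<Longrightarrow> E t + contour_integral \<beta> (\<lambda>w. \<phi> w / (w - t)) = 0"
    and st: "s \<in> C \<inter> ball u r" "t \<in> C \<inter> ball u r"
    and wn: "winding_number (\<beta> +++ \<eta>) s = 0" "winding_number (\<beta> +++ \<eta>) t \<noteq> 0"
    and z: "z \<in> U"
  shows "\<phi> z = 0"
proof -
  define F where "F x = E x - contour_integral \<eta> (\<lambda>w. \<phi> w / (w - x))" for x
  have v\<eta>: "valid_path \<eta>" by (rule valid_path_polynomial_function[OF \<eta>(1)])
  have c\<phi>: "continuous_on (path_image \<eta>) \<phi>"
    using \<phi> \<eta>(2) by (meson Diff_subset continuous_on_subset holomorphic_on_imp_continuous_on order_trans)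
  have holF: "F holomorphic_on ball u r"
  proof -
    have "(\<lambda>x. contour_integral \<eta> (\<lambda>w. \<phi> w / (w - x))) holomorphic_on - (\<lambda>w. w) ` path_image \<eta>"
      by (rule holomorphic_on_Cauchy_transform[OF \<eta>(1) c\<phi>]) (rule continuous_on_id)
    then have "(\<lambda>x. contour_integral \<eta> (\<lambda>w. \<phi> w / (w - x))) holomorphic_on ball u r"
      by (rule holomorphic_on_subset) (use \<eta>(2) in auto)
    then show ?thesis unfolding F_def by (intro holomorphic_on_diff E)
  qed
  have vloop: "valid_path (\<beta> +++ \<eta>)"
    using \<beta>(1) v\<eta> loop(1) by (rule valid_path_join)
  have closed_loop: "pathfinish (\<beta> +++ \<eta>) = pathstart (\<beta> +++ \<eta>)" using loop by simp
  have img: "path_image (\<beta> +++ \<eta>) = path_image \<beta> \<union> path_image \<eta>"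
    using loop(1) by (simp add: path_image_join)
  have W0: "winding_number (\<beta> +++ \<eta>) w = 0" if "w \<notin> U" for w
    using that \<beta>(2) \<eta>(2)
    by (intro simply_connected_imp_winding_number_zero[OF U(2)] valid_path_imp_path vloop closed_loop)
      (auto simp: img)
  have key: "F x + 2 * pi * \<i> * winding_number (\<beta> +++ \<eta>) x * \<phi> x = 0" if x: "x \<in> C \<inter> ball u r" for x
  proof -
    have xp: "x \<notin> path_image \<beta>" "x \<notin> path_image \<eta>" using x C(2) \<eta>(2) by auto
    have "((\<lambda>w. \<phi> w / (w - x)) has_contour_integral
        2 * pi * \<i> * winding_number (\<beta> +++ \<eta>) x * \<phi> x) (\<beta> +++ \<eta>)"
      using x uU xp \<beta>(2) \<eta>(2)
      by (intro Cauchy_integral_formula_global[OF U(1) \<phi> _ vloop _ closed_loop W0]) (auto simp: img)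
    moreover have "(\<lambda>w. \<phi> w / (w - x)) holomorphic_on U - {x}"
      by (intro holomorphic_intros holomorphic_on_subset[OF \<phi>]) auto
    then have "(\<lambda>w. \<phi> w / (w - x)) contour_integrable_on \<beta>" "(\<lambda>w. \<phi> w / (w - x)) contour_integrable_on \<eta>"
      using xp \<beta> v\<eta> \<eta>(2) U(1)
      by (auto intro!: contour_integrable_holomorphic_simple[where S="U - {x}"] open_delete)
    ultimately have "2 * pi * \<i> * winding_number (\<beta> +++ \<eta>) x * \<phi> x =
        contour_integral \<beta> (\<lambda>w. \<phi> w / (w - x)) + contour_integral \<eta> (\<lambda>w. \<phi> w / (w - x))"
      using contour_integral_unique \<beta>(1) v\<eta> by fastforce
    then show ?thesis using zero[OF x] by (simp add: F_def algebra_simps)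
  qed
  have const: "\<exists>e>0. ball x e \<subseteq> C \<inter> ball u r \<and>
      (\<forall>y\<in>ball x e. winding_number (\<beta> +++ \<eta>) y = winding_number (\<beta> +++ \<eta>) x)"
    if x: "x \<in> C \<inter> ball u r" for x
  proof -
    have "open (C \<inter> ball u r)" using C(1) by blast
    then obtain e where e: "e > 0" "ball x e \<subseteq> C \<inter> ball u r"
      using x open_contains_ball by meson
    have "winding_number (\<beta> +++ \<eta>) constant_on ball x e"
      by (rule winding_number_constant[OF valid_path_imp_path[OF vloop] closed_loop connected_ball])
        (use e(2) C(2) \<eta>(2) img in blast)
    then have "\<forall>y\<in>ball x e. winding_number (\<beta> +++ \<eta>) y = winding_number (\<beta> +++ \<eta>) x"
      using e(1) by (auto simp: constant_on_def)
    with e show ?thesis by blast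
  qed
  obtain e where e: "e > 0" "ball s e \<subseteq> C \<inter> ball u r"
      "\<And>y. y \<in> ball s e \<Longrightarrow> winding_number (\<beta> +++ \<eta>) y = 0"
    using const[OF st(1)] wn(1) by auto
  have F0: "F x = 0" if "x \<in> ball u r" for x
  proof (rule analytic_continuation_open[of "ball s e" "ball u r" F "\<lambda>_. 0"])
    show "F y = 0" if "y \<in> ball s e" for y
    proof -
      have y: "y \<in> C \<inter> ball u r" using e(2) that by blast
      then show ?thesis using key[OF y] e(3)[OF that] by simp
    qed
  qed (use e holF that in auto)
  obtain e' where e': "e' > 0" "ball t e' \<subseteq> C \<inter> ball u r"
      "\<And>y. y \<in> ball t e' \<Longrightarrow> winding_number (\<beta> +++ \<eta>) y = winding_number (\<beta> +++ \<eta>) t"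
    using const[OF st(2)] by blast
  show "\<phi> z = 0"
  proof (rule analytic_continuation_open[of "ball t e'" U \<phi> "\<lambda>_. 0"])
    show "\<phi> y = 0" if "y \<in> ball t e'" for y
    proof -
      have y: "y \<in> C \<inter> ball u r" using e'(2) that by blast
      then show ?thesis using key[OF y] F0[of y] e'(3)[OF that] wn(2) by auto
    qed
  qed (use e' uU U \<phi> z simply_connected_imp_connected in auto)
qed

context star_preimage
begin

definition edge_sum :: "(nat \<Rightarrow> nat \<Rightarrow> complex) \<Rightarrow> (complex \<Rightarrow> complex) \<Rightarrow> complex" where
  "edge_sum f R = (\<Sum>s=1..k. \<Sum>i=1..degree P. f s i * (R (endpoint s i) - R (B i c)))"

definition branch_sum :: "(nat \<Rightarrow> complex) \<Rightarrow> (complex \<Rightarrow> complex) \<Rightarrow> complex \<Rightarrow> complex" where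
  "branch_sum g R z = (\<Sum>i=1..degree P. g i * R (B i z))"

lemma holomorphic_branch_sum: "branch_sum g (poly Q) holomorphic_on U"
proof -
  have "(\<lambda>z. poly Q (B i z)) holomorphic_on U" if "i \<in> {1..degree P}" for i
    using holomorphic_on_compose[OF holomorphic_B[OF that], of "poly Q"]
    by (simp add: o_def poly_holomorphic_on)
  then show ?thesis
    unfolding branch_sum_def by (intro holomorphic_on_sum holomorphic_on_mult holomorphic_on_const)
qed

lemma branch_sum_has_derivative:
  assumes u: "u \<in> U"
    and R: "\<And>i. i \<in> {1..degree P} \<Longrightarrow>
      (R has_field_derivative poly (pderiv P) (B i u) * h u * N (B i u)) (at (B i u))"
  shows "(branch_sum g R has_field_derivative h u * branch_sum g N u) (at u)"
proof -
  have "((\<lambda>z. R (B i z)) has_field_derivative h u * N (B i u)) (at u)" if i: "i \<in> {1..degree P}" for i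
  proof -
    obtain D where D: "(B i has_field_derivative D) (at u)" "poly (pderiv P) (B i u) * D = 1"
      using B_has_derivative[OF i u] by blast
    have "poly (pderiv P) (B i u) * h u * N (B i u) * D = h u * N (B i u)"
    proof -
      have "poly (pderiv P) (B i u) * h u * N (B i u) * D =
          (poly (pderiv P) (B i u) * D) * (h u * N (B i u))" by (simp only: mult_ac)
      then show ?thesis by (simp only: D(2) mult_1_left)
    qed
    then show ?thesis using DERIV_chain2[OF R[OF i] D(1)] by (simp only:)
  qed
  then have "((\<lambda>z. \<Sum>i=1..degree P. g i * R (B i z)) has_field_derivative
      (\<Sum>i=1..degree P. g i * (h u * N (B i u)))) (at u)"
    by (intro DERIV_sum DERIV_cmult) auto
  then show ?thesis unfolding branch_sum_def
    by (simp add: sum_distrib_left mult_ac cong: sum.cong)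
qed

lemma branch_sum_contour_integral:
  assumes p: "valid_path p" "path_image p \<subseteq> U"
    and R: "\<And>i u. i \<in> {1..degree P} \<Longrightarrow> u \<in> path_image p \<Longrightarrow>
      (R has_field_derivative poly (pderiv P * Q) (B i u) / (poly P (B i u) - t)) (at (B i u))"
  shows "((\<lambda>u. branch_sum g (poly Q) u / (u - t)) has_contour_integral
    branch_sum g R (pathfinish p) - branch_sum g R (pathstart p)) p"
proof (rule contour_integral_primitive[OF _ p(1) order.refl])
  fix u assume u: "u \<in> path_image p"
  have "(branch_sum g R has_field_derivative 1 / (u - t) * branch_sum g (poly Q) u) (at u)"
  proof (rule branch_sum_has_derivative)
    show uU: "u \<in> U" using u p(2) by blast
    show "(R has_field_derivative poly (pderiv P) (B i u) * (1 / (u - t)) * poly Q (B i u)) (at (B i u))"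
      if i: "i \<in> {1..degree P}" for i
      using R[OF i u] poly_B[OF i uU] by simp
  qed
  then show "(branch_sum g R has_field_derivative branch_sum g (poly Q) u / (u - t)) (at u within path_image p)"
    by (simp add: has_field_derivative_at_within)
qed

lemma compact_star: "compact (star_set k \<gamma>)"
  unfolding star_set_def using arc_\<gamma> by (intro compact_UN) (auto intro: compact_arc_image)

lemma connected_complement_star: "connected (- star_set k \<gamma>)"
  unfolding star_set_def
proof (rule connected_complement_Union_arcs)
  show "c \<in> path_image (\<gamma> s)" if "s \<in> {1..k}" for s
    using \<gamma>_0[OF that] pathstart_in_path_image[of "\<gamma> s"] by (simp add: pathstart_def)
qed (use arc_\<gamma> \<gamma>_Int in auto)

lemma final_segments_near_endpoints:
  assumes O: "open V" "cs ` {1..k} \<subseteq> V" and l: "l < 1"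
  obtains y where "\<And>s. l < y s" "\<And>s. 0 < y s" "\<And>s. y s < 1"
    "\<And>s i. s \<in> {1..k} \<Longrightarrow> i \<in> {1..degree P} \<Longrightarrow>
      poly P ` closed_segment (B i (\<gamma> s (y s))) (endpoint s i) \<subseteq> V"
proof -
  have "\<exists>y. max l 0 < y \<and> y < 1 \<and> (s \<in> {1..k} \<longrightarrow> (\<forall>i\<in>{1..degree P}.
      poly P ` closed_segment (B i (\<gamma> s y)) (endpoint s i) \<subseteq> V))" for s
  proof (cases "s \<in> {1..k}")
    case s: True
    have "\<forall>\<^sub>F y in at_left 1. poly P ` closed_segment (B i (\<gamma> s y)) (endpoint s i) \<subseteq> V"
      if i: "i \<in> {1..degree P}" for i
    proof -
      have "open (poly P -` V)"
        by (intro open_vimage O continuous_intros)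
      moreover have "endpoint s i \<in> poly P -` V" using poly_endpoint[OF s i] O(2) s by auto
      ultimately obtain e where e: "e > 0" "ball (endpoint s i) e \<subseteq> poly P -` V"
        using open_contains_ball by meson
      have "\<forall>\<^sub>F y in at_left 1. dist (B i (\<gamma> s y)) (endpoint s i) < e"
        using tendstoD[OF B_\<gamma>_tendsto[OF s i] e(1)] .
      then show ?thesis
      proof (rule eventually_mono)
        fix y assume "dist (B i (\<gamma> s y)) (endpoint s i) < e"
        then have "closed_segment (B i (\<gamma> s y)) (endpoint s i) \<subseteq> ball (endpoint s i) e"
          using e(1) by (intro closed_segment_subset) (auto simp: dist_commute)
        then show "poly P ` closed_segment (B i (\<gamma> s y)) (endpoint s i) \<subseteq> V" using e(2) by blast
      qed
    qed
    then have "\<forall>\<^sub>F y in at_left 1. \<forall>i\<in>{1..degree P}.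
        poly P ` closed_segment (B i (\<gamma> s y)) (endpoint s i) \<subseteq> V"
      by (intro eventually_ball_finite) auto
    moreover have "\<forall>\<^sub>F y in at_left 1. max l 0 < y \<and> y < (1::real)"
      unfolding eventually_at_left_field using l by (intro exI[of _ "max l 0"]) auto
    ultimately have "\<forall>\<^sub>F y in at_left 1. (max l 0 < y \<and> y < (1::real)) \<and> (\<forall>i\<in>{1..degree P}.
        poly P ` closed_segment (B i (\<gamma> s y)) (endpoint s i) \<subseteq> V)"
      by (rule eventually_conj[rotated])
    then show ?thesis using eventually_happens' trivial_limit_at_left_real by blast
  next
    case False
    then show ?thesis using l dense[of "max l 0" 1] by auto
  qed
  then obtain y where "\<forall>s. max l 0 < y s \<and> y s < 1 \<and> (s \<in> {1..k} \<longrightarrow> (\<forall>i\<in>{1..degree P}.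
      poly P ` closed_segment (B i (\<gamma> s (y s))) (endpoint s i) \<subseteq> V))"
    by metis
  then show ?thesis by (intro that[of y]) auto
qed

end

lemma polynomial_function_linepath: "polynomial_function (linepath a b)"
  for a b :: "'a::real_normed_vector"
proof -
  have eq: "linepath a b = (\<lambda>x. a + x *\<^sub>R (b - a))" by (auto simp: linepath_def algebra_simps)
  have "bounded_linear (\<lambda>x. x *\<^sub>R (b - a))" by (rule bounded_linear_scaleR_left)
  then show ?thesis unfolding eq
    by (intro polynomial_function_add polynomial_function_const polynomial_function_bounded_linear)
qed

context star_preimage
begin

text \<open>Up to a point near its end each arc is replaced by a polynomial path in \<open>U\<close>, and the rest of its
  lift by a line segment into the endpoint. In the proof, \<open>\<beta>\<close> replaces the part of \<open>\<gamma> s0\<close> crossing a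
  small disc, \<open>\<eta>\<close> is a detour around the disc, and \<open>E\<close> collects all other pieces. The set \<open>T\<close>, which
  the pieces avoid, joins both sides of the arc to infinity.\<close>

lemma branch_sums_vanish:
  assumes H: "\<exists>R0. \<forall>R\<ge>R0. \<exists>M. \<forall>t. M < norm t \<longrightarrow> (\<forall>g.
      (\<forall>z\<in>ball 0 R. (g has_field_derivative poly (pderiv P * Q) z / (poly P z - t)) (at z)) \<longrightarrow>
      edge_sum f g = 0)"
    and s0: "s0 \<in> {1..k}" and z: "z \<in> U"
  shows "branch_sum (f s0) (poly Q) z = 0"
proof -
  let ?\<phi> = "\<lambda>s. branch_sum (f s) (poly Q)"
  let ?N = "poly (pderiv P * Q)"
  let ?S = "star_set k \<gamma>"
  note c\<gamma> = continuous_\<gamma>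
  have p\<gamma>: "path (\<gamma> s)" if "s \<in> {1..k}" for s using arc_\<gamma>[OF that] arc_imp_path by blast
  define u where "u = \<gamma> s0 (1/2)"
  have uU: "u \<in> U" using \<gamma>_in_U[OF s0] by (simp add: u_def)
  have inj: "inj_on (\<gamma> s0) {0..1}" using arc_\<gamma>[OF s0] by (simp add: arc_def)
  have une: "u \<noteq> c" "u \<noteq> cs s0"
    using inj_onD[OF inj, of "1/2" 0] inj_onD[OF inj, of "1/2" 1] \<gamma>_0[OF s0] \<gamma>_1[OF s0]
    by (auto simp: u_def)
  obtain R where R: "R > 0" "cball u R \<subseteq> U" "R < dist u c" "R < dist u (cs s0)"
  proof -
    obtain R' where "R' > 0" "cball u R' \<subseteq> U" using open_U uU open_contains_cball by meson
    moreover define R where "R = min R' (min (dist u c / 2) (dist u (cs s0) / 2))"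
    moreover have "0 < dist u c" "0 < dist u (cs s0)" using une by auto
    ultimately have "R > 0" "R \<le> R'" "R < dist u c" "R < dist u (cs s0)"
      unfolding R_def by linarith+
    then show ?thesis using that \<open>cball u R' \<subseteq> U\<close> by (meson order_trans subset_cball)
  qed
  obtain x1 x2 h where x: "0 \<le> x1" "x1 < 1/2" "1/2 < x2" "x2 \<le> 1"
    and sub: "\<gamma> s0 ` {x1..x2} \<subseteq> cball u R"
    and h: "path h" "path_image h \<subseteq> sphere u R" "pathstart h = \<gamma> s0 x2" "pathfinish h = \<gamma> s0 x1"
    and simple: "simple_path (subpath x1 x2 (\<gamma> s0) +++ h)"
  proof -
    have "0 < (1/2::real)" "(1/2::real) < 1" "R \<le> dist (\<gamma> s0 (1/2)) (\<gamma> s0 0)" "R \<le> dist (\<gamma> s0 (1/2)) (\<gamma> s0 1)"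
      using R \<gamma>_0[OF s0] \<gamma>_1[OF s0] by (auto simp: u_def)
    then show ?thesis
      by (rule arc_closed_up_in_disc[OF arc_\<gamma>[OF s0] _ _ R(1)]) (rule that[unfolded u_def]; assumption)
  qed
  have x2: "x2 < 1"
  proof (rule ccontr)
    assume "\<not> x2 < 1"
    then have "pathstart h = cs s0" using x(4) h(3) \<gamma>_1[OF s0] by simp
    then show False using R(4) h(2) pathstart_in_path_image[of h] by auto
  qed
  define lp where "lp = subpath x1 x2 (\<gamma> s0) +++ h"
  have lpimg: "path_image lp = \<gamma> s0 ` {x1..x2} \<union> path_image h"
    using h(3) x by (simp add: lp_def path_image_join path_image_subpath)
  define Z where "Z = (\<Union>s\<in>{1..k} - {s0}. path_image (\<gamma> s)) \<union> \<gamma> s0 ` ({0..x1} \<union> {x2..1})"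
  have "compact Z"
    unfolding Z_def using x arc_\<gamma>
    by (intro compact_Un compact_UN compact_continuous_image continuous_on_subset[OF c\<gamma>[OF s0]])
      (auto intro: compact_arc_image)
  moreover have "u \<notin> Z"
  proof
    assume "u \<in> Z"
    then consider s where "s \<in> {1..k} - {s0}" "u \<in> path_image (\<gamma> s)"
      | y where "y \<in> {0..x1} \<union> {x2..1}" "u = \<gamma> s0 y" unfolding Z_def by blast
    then show False
    proof cases
      case 1
      have "u \<in> path_image (\<gamma> s0)" by (simp add: u_def path_image_def)
      then show False using 1 \<gamma>_Int[of s s0] s0 une by auto
    next
      case 2
      then show False using inj_onD[OF inj, of "1/2" y] x by (auto simp: u_def)
    qed
  qed
  ultimately obtain d where d: "d > 0" "\<And>w. w \<in> Z \<Longrightarrow> d \<le> dist u w"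
    using separate_point_closed[OF compact_imp_closed, of Z u] by auto
  define r where "r = min d R / 2"
  have r: "r > 0" "r < R" "cball u r \<inter> Z = {}"
    using d R(1) by (auto simp: r_def min_def) (smt (verit))+
  have SZ: "?S \<subseteq> Z \<union> \<gamma> s0 ` {x1..x2}"
  proof
    fix w assume "w \<in> ?S"
    then obtain s y where sy: "s \<in> {1..k}" "y \<in> {0..1}" "w = \<gamma> s y"
      by (auto simp: star_set_def path_image_def)
    show "w \<in> Z \<union> \<gamma> s0 ` {x1..x2}"
    proof (cases "s = s0")
      case True
      then show ?thesis using sy by (cases "y \<in> {x1..x2}") (auto simp: Z_def)
    next
      case False
      then show ?thesis using sy unfolding Z_def path_image_def by blast
    qed
  qed
  have ulp: "u \<in> path_image lp" using x by (auto simp: lpimg u_def)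
  have lploop: "pathfinish lp = pathstart lp" using h by (simp add: lp_def)
  obtain s t where st: "s \<in> ball u r - path_image lp" "t \<in> ball u r - path_image lp"
    and wn: "winding_number lp s = 0" "winding_number lp t \<noteq> 0"
    using simple_loop_winding_number_jump[OF _ lploop ulp r(1)] simple unfolding lp_def by blast
  have stS: "s \<notin> ?S" "t \<notin> ?S" using st r(3) SZ ball_subset_cball[of u r] unfolding lpimg by blast+
  obtain M0 where M0: "?S \<subseteq> ball 0 M0" "M0 > 0"
    using bounded_subset_ballD[OF compact_imp_bounded[OF compact_star], of 0] by blast
  define w0 where "w0 = complex_of_real M0"
  have pc: "path_connected (- ?S)"
    using connected_open_path_connected[OF _ connected_complement_star] compact_star
    by (simp add: compact_imp_closed open_Compl)
  have w0S: "w0 \<notin> ?S" using M0 by (auto simp: w0_def)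
  obtain p1 where p1: "path p1" "path_image p1 \<subseteq> - ?S" "pathstart p1 = s" "pathfinish p1 = w0"
    using pc stS w0S unfolding path_connected_def by blast
  obtain p2 where p2: "path p2" "path_image p2 \<subseteq> - ?S" "pathstart p2 = t" "pathfinish p2 = w0"
    using pc stS w0S unfolding path_connected_def by blast
  define T where "T = path_image p1 \<union> path_image p2 \<union> - ball 0 M0"
  have T: "closed T" "connected T" "T \<inter> ?S = {}" "s \<in> T" "t \<in> T" "w0 \<in> T"
  proof -
    show "closed T" unfolding T_def
      by (intro closed_Un closed_path_image p1 p2) (simp add: closed_Compl)
    have "connected (- ball (0::complex) M0)"
      by (intro connected_complement_bounded_convex) auto
    moreover have "w0 \<in> path_image p1" "w0 \<in> path_image p2" "w0 \<in> - ball 0 M0"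
      using p1(4) p2(4) pathfinish_in_path_image[of p1] pathfinish_in_path_image[of p2] M0(2)
      by (auto simp: w0_def)
    moreover have "connected (path_image p1)" "connected (path_image p2)"
      using p1(1) p2(1) connected_path_image by blast+
    ultimately show "connected T" unfolding T_def by (intro connected_Un) auto
    show "T \<inter> ?S = {}" using p1(2) p2(2) M0 by (auto simp: T_def)
    show "s \<in> T" "t \<in> T" "w0 \<in> T"
      using p1 p2 pathstart_in_path_image[of p1] pathstart_in_path_image[of p2] M0(2)
      by (auto simp: T_def w0_def)
  qed
  define V where "V = - (T \<union> cball u r)"
  have openV: "open V" unfolding V_def using T(1) by (intro open_Compl closed_Un) auto
  have \<gamma>S: "\<gamma> j y \<in> ?S" if "j \<in> {1..k}" "0 \<le> y" "y \<le> 1" for j y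
  proof -
    have "y \<in> {0..1}" using that by simp
    then show ?thesis using that(1) unfolding star_set_def path_image_def by blast
  qed
  have \<gamma>V: "\<gamma> j y \<in> V" if "j \<in> {1..k}" "0 \<le> y" "y \<le> 1" "j = s0 \<longrightarrow> y \<le> x1 \<or> x2 \<le> y" for j y
  proof -
    have "\<gamma> j y \<in> Z"
    proof (cases "j = s0")
      case True
      then show ?thesis using that unfolding Z_def by auto
    next
      case False
      moreover have "y \<in> {0..1}" using that by simp
      ultimately show ?thesis using that(1) unfolding Z_def path_image_def by blast
    qed
    then show ?thesis using r(3) T(3) \<gamma>S[OF that(1-3)] unfolding V_def by blast
  qed
  have "cs ` {1..k} \<subseteq> V"
  proof
    fix w assume "w \<in> cs ` {1..k}"
    then obtain j where j: "j \<in> {1..k}" "w = \<gamma> j 1" using \<gamma>_1 by auto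
    show "w \<in> V" unfolding j(2) by (rule \<gamma>V) (use j x in auto)
  qed
  then obtain y where y: "\<And>j. x2 < y j" "\<And>j. 0 < y j" "\<And>j. y j < 1"
    and seg: "\<And>j i. j \<in> {1..k} \<Longrightarrow> i \<in> {1..degree P} \<Longrightarrow>
      poly P ` closed_segment (B i (\<gamma> j (y j))) (endpoint j i) \<subseteq> V"
    using final_segments_near_endpoints[OF openV _ x2] by metis
  define e where "e j = (if j = s0 then x2 else 0)" for j
  have e: "0 \<le> e j" "e j < y j" for j using x y(1,2)[of j] by (auto simp: e_def)
  have approx: "\<exists>p. polynomial_function p \<and> homotopic_paths (U \<inter> O') (subpath l m (\<gamma> j)) p"
    if "j \<in> {1..k}" "0 \<le> l" "l \<le> m" "m < 1" "open O'" "\<And>y. l \<le> y \<Longrightarrow> y \<le> m \<Longrightarrow> \<gamma> j y \<in> O'" for j l m O'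
  proof -
    have "path (subpath l m (\<gamma> j))" using that by (intro path_subpath p\<gamma>) auto
    moreover have "path_image (subpath l m (\<gamma> j)) \<subseteq> U \<inter> O'"
      using that \<gamma>_in_U[OF that(1)] by (auto simp: path_image_subpath)
    ultimately show ?thesis
      using homotopic_polynomial_path[of "U \<inter> O'"] open_U that(5) by (metis open_Int)
  qed
  have "\<exists>p. polynomial_function p \<and> homotopic_paths (U \<inter> V) (subpath (e j) (y j) (\<gamma> j)) p"
    if "j \<in> {1..k}" for j
    by (rule approx) (use that e[of j] y(3)[of j] openV \<gamma>V[OF that] in \<open>auto simp: e_def split: if_splits\<close>)
  then obtain \<delta> where \<delta>: "\<And>j. j \<in> {1..k} \<Longrightarrow> polynomial_function (\<delta> j)"
      "\<And>j. j \<in> {1..k} \<Longrightarrow> homotopic_paths (U \<inter> V) (subpath (e j) (y j) (\<gamma> j)) (\<delta> j)"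
    by metis
  have "\<exists>p. polynomial_function p \<and> homotopic_paths (U \<inter> V) (subpath 0 x1 (\<gamma> s0)) p"
    by (rule approx) (use s0 x openV \<gamma>V[OF s0] in auto)
  then obtain \<alpha> where \<alpha>: "polynomial_function \<alpha>" "homotopic_paths (U \<inter> V) (subpath 0 x1 (\<gamma> s0)) \<alpha>"
    by blast
  have "\<exists>p. polynomial_function p \<and> homotopic_paths (U \<inter> - T) (subpath x1 x2 (\<gamma> s0)) p"
    by (rule approx) (use s0 x x2 T \<gamma>S[OF s0] in \<open>auto simp: open_Compl\<close>)
  then obtain \<beta> where \<beta>: "polynomial_function \<beta>" "homotopic_paths (U \<inter> - T) (subpath x1 x2 (\<gamma> s0)) \<beta>"
    by blast
  have "path_image h \<subseteq> U - cball u r"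
    using h(2) R(2) r(2) by (force simp: sphere_def cball_def)
  then obtain \<eta> where \<eta>: "polynomial_function \<eta>" "homotopic_paths (U - cball u r) h \<eta>"
    using homotopic_polynomial_path[of "U - cball u r" h] h(1) open_U by (metis open_Diff closed_cball)
  have \<delta>': "path_image (\<delta> j) \<subseteq> U \<inter> V" "pathstart (\<delta> j) = \<gamma> j (e j)" "pathfinish (\<delta> j) = \<gamma> j (y j)"
      "valid_path (\<delta> j)"
    if "j \<in> {1..k}" for j
    using homotopic_paths_imp_subset[OF \<delta>(2)[OF that]] homotopic_paths_imp_pathstart[OF \<delta>(2)[OF that]]
      homotopic_paths_imp_pathfinish[OF \<delta>(2)[OF that]] valid_path_polynomial_function[OF \<delta>(1)[OF that]]
    by auto
  have \<alpha>': "path_image \<alpha> \<subseteq> U \<inter> V" "pathstart \<alpha> = c" "pathfinish \<alpha> = \<gamma> s0 x1" "valid_path \<alpha>"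
    using homotopic_paths_imp_subset[OF \<alpha>(2)] homotopic_paths_imp_pathstart[OF \<alpha>(2)]
      homotopic_paths_imp_pathfinish[OF \<alpha>(2)] valid_path_polynomial_function[OF \<alpha>(1)] \<gamma>_0[OF s0]
    by auto
  have \<beta>': "path_image \<beta> \<subseteq> U - T" "pathstart \<beta> = \<gamma> s0 x1" "pathfinish \<beta> = \<gamma> s0 x2" "valid_path \<beta>"
    using homotopic_paths_imp_subset[OF \<beta>(2)] homotopic_paths_imp_pathstart[OF \<beta>(2)]
      homotopic_paths_imp_pathfinish[OF \<beta>(2)] valid_path_polynomial_function[OF \<beta>(1)]
    by auto
  have \<eta>': "path_image \<eta> \<subseteq> U - cball u r" "pathstart \<eta> = \<gamma> s0 x2" "pathfinish \<eta> = \<gamma> s0 x1"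
    using homotopic_paths_imp_subset[OF \<eta>(2)] homotopic_paths_imp_pathstart[OF \<eta>(2)]
      homotopic_paths_imp_pathfinish[OF \<eta>(2)] h
    by auto
  have wn_eq: "winding_number (\<beta> +++ \<eta>) w = winding_number lp w" if "w \<in> T" "w \<in> ball u r" for w
  proof -
    have "homotopic_paths (- {w}) lp (\<beta> +++ \<eta>)"
      unfolding lp_def
    proof (rule homotopic_paths_join)
      show "homotopic_paths (- {w}) (subpath x1 x2 (\<gamma> s0)) \<beta>"
        by (rule homotopic_paths_subset[OF \<beta>(2)]) (use that in auto)
      show "homotopic_paths (- {w}) h \<eta>"
        by (rule homotopic_paths_subset[OF \<eta>(2)]) (use that in auto)
    qed (use h in simp)
    then show ?thesis using winding_number_homotopic_paths by metis
  qed
  define E where "E w = (\<Sum>j=1..k. contour_integral (\<delta> j) (\<lambda>v. ?\<phi> j v / (v - w)))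
      + contour_integral \<alpha> (\<lambda>v. ?\<phi> s0 v / (v - w))
      + (\<Sum>j=1..k. \<Sum>i=1..degree P. f j i *
          contour_integral (linepath (B i (\<gamma> j (y j))) (endpoint j i)) (\<lambda>z. ?N z / (poly P z - w)))" for w
  define X where "X = (\<Union>j\<in>{1..k}. path_image (\<delta> j)) \<union> path_image \<alpha> \<union>
      (\<Union>j\<in>{1..k}. \<Union>i\<in>{1..degree P}. poly P ` closed_segment (B i (\<gamma> j (y j))) (endpoint j i))"
  have XV: "X \<subseteq> V" using \<delta>'(1) \<alpha>'(1) seg unfolding X_def by blast
  have "compact X" unfolding X_def using \<delta>'(4) \<alpha>'(4)
    by (intro compact_Un compact_UN compact_path_image valid_path_imp_path compact_continuous_image
        continuous_intros compact_segment) auto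
  then have openX: "open (- X)" by (simp add: compact_imp_closed open_Compl)
  have cauchy: "(\<lambda>w. contour_integral p (\<lambda>v. ?\<phi> j v / (v - w))) holomorphic_on - path_image p"
    if "polynomial_function p" "path_image p \<subseteq> U" for p j
    using holomorphic_on_Cauchy_transform[OF that(1), of "?\<phi> j" "\<lambda>v. v"]
      continuous_on_subset[OF holomorphic_on_imp_continuous_on[OF holomorphic_branch_sum] that(2)]
    by auto
  have holE: "E holomorphic_on - X"
    unfolding E_def
  proof (intro holomorphic_on_add holomorphic_on_sum holomorphic_on_mult holomorphic_on_const)
    show "(\<lambda>w. contour_integral (\<delta> j) (\<lambda>v. ?\<phi> j v / (v - w))) holomorphic_on - X" if "j \<in> {1..k}" for j
      by (rule holomorphic_on_subset[OF cauchy[OF \<delta>(1)]]) (use that \<delta>'(1)[OF that] in \<open>auto simp: X_def\<close>)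
    show "(\<lambda>w. contour_integral \<alpha> (\<lambda>v. ?\<phi> s0 v / (v - w))) holomorphic_on - X"
      by (rule holomorphic_on_subset[OF cauchy[OF \<alpha>(1)]]) (use \<alpha>'(1) in \<open>auto simp: X_def\<close>)
    show "(\<lambda>w. contour_integral (linepath (B i (\<gamma> j (y j))) (endpoint j i)) (\<lambda>z. ?N z / (poly P z - w)))
        holomorphic_on - X" if "j \<in> {1..k}" "i \<in> {1..degree P}" for i j
    proof (rule holomorphic_on_subset[OF holomorphic_on_Cauchy_transform[OF polynomial_function_linepath]])
      show "- X \<subseteq> - poly P ` path_image (linepath (B i (\<gamma> j (y j))) (endpoint j i))"
        using that unfolding X_def path_image_linepath by blast
    qed (intro continuous_intros)+
  qed
  define F where "F w = E w + contour_integral \<beta> (\<lambda>v. ?\<phi> s0 v / (v - w))" for w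
  define W where "W = - (X \<union> path_image \<beta>)"
  have openW: "open W"
    unfolding W_def using \<open>compact X\<close> \<beta>'(4)
    by (intro open_Compl compact_imp_closed compact_Un compact_path_image valid_path_imp_path)
  have holF: "F holomorphic_on W"
    unfolding F_def W_def
    by (intro holomorphic_on_add holomorphic_on_subset[OF holE] holomorphic_on_subset[OF cauchy[OF \<beta>(1)]])
      (use \<beta>'(1) in auto)
  have TW: "T \<subseteq> W" using XV \<beta>'(1) by (auto simp: W_def V_def)
  have large: "\<exists>M. \<forall>w. M < norm w \<longrightarrow> F w = 0"
  proof -
    define K where "K = (\<Union>j\<in>{1..k}. path_image (\<delta> j)) \<union> path_image \<alpha> \<union> path_image \<beta>"
    have "compact K" unfolding K_def using \<delta>'(4) \<alpha>'(4) \<beta>'(4)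
      by (intro compact_Un compact_UN compact_path_image valid_path_imp_path) auto
    have KU: "K \<subseteq> U" using \<delta>'(1) \<alpha>'(1) \<beta>'(1) unfolding K_def by blast
    define Y where "Y = (\<Union>i\<in>{1..degree P}. B i ` K) \<union>
      (\<Union>j\<in>{1..k}. \<Union>i\<in>{1..degree P}. closed_segment (B i (\<gamma> j (y j))) (endpoint j i))"
    have "continuous_on K (B i)" if "i \<in> {1..degree P}" for i
      using holomorphic_on_imp_continuous_on[OF holomorphic_B[OF that]] KU continuous_on_subset by blast
    then have "compact Y" unfolding Y_def
      using \<open>compact K\<close>
      by (intro compact_Un compact_UN compact_continuous_image compact_segment) auto
    then obtain R' where R': "Y \<subseteq> ball 0 R'" using bounded_subset_ballD compact_imp_bounded by metis
    obtain R0 where R0: "\<And>R. R \<ge> R0 \<Longrightarrow> \<exists>M. \<forall>t. M < norm t \<longrightarrow> (\<forall>g.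
      (\<forall>z\<in>ball 0 R. (g has_field_derivative ?N z / (poly P z - t)) (at z)) \<longrightarrow> edge_sum f g = 0)"
      using H by blast
    define R1 where "R1 = max R' R0"
    have YR: "Y \<subseteq> ball 0 R1" using R' by (auto simp: R1_def)
    obtain M1 where M1: "\<And>t g. M1 < norm t \<Longrightarrow>
      (\<And>z. z\<in>ball 0 R1 \<Longrightarrow> (g has_field_derivative ?N z / (poly P z - t)) (at z)) \<Longrightarrow> edge_sum f g = 0"
      using R0[of R1] by (metis R1_def max.cobounded2)
    have "bounded (poly P ` cball 0 R1)"
      by (intro compact_imp_bounded compact_continuous_image continuous_intros compact_cball)
    then obtain M2 where M2: "\<And>z. z \<in> ball 0 R1 \<Longrightarrow> norm (poly P z) \<le> M2"
      unfolding bounded_iff using ball_subset_cball by blast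
    have "F w = 0" if w: "max M1 M2 < norm w" for w
    proof -
      have ne: "poly P z - w \<noteq> 0" if "z \<in> ball 0 R1" for z using M2[OF that] w by auto
      have "(\<lambda>z. ?N z / (poly P z - w)) holomorphic_on ball 0 R1"
        using ne by (intro holomorphic_intros) auto
      then obtain g where g: "\<And>z. z \<in> ball 0 R1 \<Longrightarrow>
          (g has_field_derivative ?N z / (poly P z - w)) (at z within ball 0 R1)"
        by (rule holomorphic_convex_primitive'[OF convex_ball open_ball]) blast
      have g': "(g has_field_derivative ?N z / (poly P z - w)) (at z)" if "z \<in> ball 0 R1" for z
        using g[OF that] by (simp only: at_within_open[OF that open_ball])
      have BK: "B i v \<in> ball 0 R1" if "i \<in> {1..degree P}" "v \<in> K" for i v
        using that YR unfolding Y_def by blast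
      have int: "contour_integral p (\<lambda>v. ?\<phi> j v / (v - w)) =
          branch_sum (f j) g (pathfinish p) - branch_sum (f j) g (pathstart p)"
        if "valid_path p" "path_image p \<subseteq> K" for p j
        using that KU BK g'
        by (intro contour_integral_unique branch_sum_contour_integral) blast+
      have int_line: "contour_integral (linepath (B i (\<gamma> j (y j))) (endpoint j i)) (\<lambda>z. ?N z / (poly P z - w))
          = g (endpoint j i) - g (B i (\<gamma> j (y j)))" if "j \<in> {1..k}" "i \<in> {1..degree P}" for i j
      proof -
        have "closed_segment (B i (\<gamma> j (y j))) (endpoint j i) \<subseteq> ball 0 R1"
          using that YR unfolding Y_def by blast
        then show ?thesis
          using contour_integral_unique[OF contour_integral_primitive[OF g valid_path_linepath]] by simp
      qed
      have "F w = (\<Sum>j=1..k. branch_sum (f j) g (\<gamma> j (y j)) - branch_sum (f j) g (\<gamma> j (e j)))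
        + (branch_sum (f s0) g (\<gamma> s0 x2) - branch_sum (f s0) g c)
        + (\<Sum>j=1..k. \<Sum>i=1..degree P. f j i * (g (endpoint j i) - g (B i (\<gamma> j (y j)))))"
      proof -
        have "contour_integral (\<delta> j) (\<lambda>v. ?\<phi> j v / (v - w)) =
            branch_sum (f j) g (\<gamma> j (y j)) - branch_sum (f j) g (\<gamma> j (e j))" if "j \<in> {1..k}" for j
        proof -
          have "path_image (\<delta> j) \<subseteq> K" using that unfolding K_def by blast
          then show ?thesis using int[of "\<delta> j"] \<delta>'[OF that] by simp
        qed
        moreover have "contour_integral \<alpha> (\<lambda>v. ?\<phi> s0 v / (v - w)) =
            branch_sum (f s0) g (\<gamma> s0 x1) - branch_sum (f s0) g c"
          using int[of \<alpha>] \<alpha>' by (auto simp: K_def)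
        moreover have "contour_integral \<beta> (\<lambda>v. ?\<phi> s0 v / (v - w)) =
            branch_sum (f s0) g (\<gamma> s0 x2) - branch_sum (f s0) g (\<gamma> s0 x1)"
          using int[of \<beta>] \<beta>' by (auto simp: K_def)
        ultimately show ?thesis by (simp add: F_def E_def int_line del: poly_mult)
      qed
      also have "(\<Sum>j=1..k. \<Sum>i=1..degree P. f j i * (g (endpoint j i) - g (B i (\<gamma> j (y j))))) =
          edge_sum f g + (\<Sum>j=1..k. branch_sum (f j) g c - branch_sum (f j) g (\<gamma> j (y j)))"
        by (simp add: edge_sum_def branch_sum_def sum_subtractf right_diff_distrib)
      also have "(\<Sum>j=1..k. branch_sum (f j) g (\<gamma> j (y j)) - branch_sum (f j) g (\<gamma> j (e j)))
        + (branch_sum (f s0) g (\<gamma> s0 x2) - branch_sum (f s0) g c)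
        + (edge_sum f g + (\<Sum>j=1..k. branch_sum (f j) g c - branch_sum (f j) g (\<gamma> j (y j))))
        = edge_sum f g + ((\<Sum>j=1..k. branch_sum (f j) g c - branch_sum (f j) g (\<gamma> j (e j)))
          - (branch_sum (f s0) g c - branch_sum (f s0) g (\<gamma> s0 x2)))"
        by (simp add: sum_subtractf)
      also have "(\<Sum>j=1..k. branch_sum (f j) g c - branch_sum (f j) g (\<gamma> j (e j))) =
          (\<Sum>j=1..k. if j = s0 then branch_sum (f s0) g c - branch_sum (f s0) g (\<gamma> s0 x2) else 0)"
        by (intro sum.cong) (auto simp: e_def \<gamma>_0)
      also have "\<dots> = branch_sum (f s0) g c - branch_sum (f s0) g (\<gamma> s0 x2)"
        using s0 by simp
      also have "edge_sum f g = 0" using M1[of w g] w g' by auto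
      finally show ?thesis by simp
    qed
    then show ?thesis by blast
  qed
  define C where "C = connected_component_set W w0"
  have openC: "open C" unfolding C_def using openW by (rule open_connected_component)
  have TC: "T \<subseteq> C" unfolding C_def using T TW by (intro connected_component_maximal) auto
  have CW: "C \<subseteq> W" unfolding C_def by (rule connected_component_subset)
  obtain M where M: "\<And>w. M < norm w \<Longrightarrow> F w = 0" using large by blast
  have F0: "F w = 0" if "w \<in> C" for w
  proof (rule analytic_continuation_open[of "- cball 0 (max M M0)" C F "\<lambda>_. 0"])
    show "- cball 0 (max M M0) \<subseteq> C" using TC by (auto simp: T_def)
    show "connected C" unfolding C_def by simp
    have "norm (complex_of_real (max M M0 + 1)) = max M M0 + 1"
      unfolding norm_of_real using M0(2) by simp
    then have "complex_of_real (max M M0 + 1) \<in> - cball 0 (max M M0)" by simp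
    then show "- cball 0 (max M M0) \<noteq> ({}::complex set)" by blast
    show "F w = 0" if "w \<in> - cball 0 (max M M0)" for w
      using that by (intro M) auto
  qed (use openC holF CW that in \<open>auto intro: holomorphic_on_subset\<close>)
  show ?thesis
  proof (rule density_zero_if_no_jump[OF open_U simply_connected_U holomorphic_branch_sum])
    show "ball u r \<subseteq> U" using R(2) r(2) by force
    show "path_image \<eta> \<subseteq> U - ball u r" using \<eta>'(1) by force
    show "E holomorphic_on ball u r"
      by (rule holomorphic_on_subset[OF holE]) (use XV in \<open>auto simp: V_def\<close>)
    show "C \<inter> path_image \<beta> = {}" using CW by (auto simp: W_def)
    show "E w + contour_integral \<beta> (\<lambda>v. ?\<phi> s0 v / (v - w)) = 0" if "w \<in> C \<inter> ball u r" for w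
      using F0[of w] that by (simp add: F_def)
    show "s \<in> C \<inter> ball u r" "t \<in> C \<inter> ball u r" using TC T(4,5) st by auto
    show "winding_number (\<beta> +++ \<eta>) s = 0" "winding_number (\<beta> +++ \<eta>) t \<noteq> 0"
      using wn_eq[of s] wn_eq[of t] T(4,5) st wn by auto
  qed (use \<beta>' \<eta> \<eta>' openC z in auto)
qed

end

section \<open>The cactus is a tree\<close>

context wf_digraph
begin

lemma apath_imp_distinct: "apath u p v \<Longrightarrow> distinct p"
  unfolding apath_def using distinct_verts_imp_distinct by blast

lemma awalk_telescope:
  fixes R :: "'a \<Rightarrow> 'c::ab_group_add"
  assumes "awalk u p v"
  shows "(\<Sum>e\<leftarrow>p. R (head G e) - R (tail G e)) = R v - R u"
  using assms by (induction p arbitrary: u) (auto simp: awalk_simps)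

lemma apath_no_backtrack:
  assumes "apath u p v" "e \<in> set p" "e' \<in> set p" "tail G e = head G e'" "head G e = tail G e'"
  shows False
  using assms
proof (induction p arbitrary: u)
  case (Cons d p)
  then have p: "apath (head G d) p v" "tail G d \<notin> set (awalk_verts (head G d) p)"
    by (auto simp: apath_Cons_iff)
  then have w: "awalk (head G d) p v" by (simp add: apath_def)
  have "tail G d \<noteq> head G x" if "x \<in> set (d # p)" for x
    using that hd_in_awalk_verts(1)[OF w] awalk_verts_arc2[OF w, of x] p(2) by (metis set_ConsD)
  then have "e \<noteq> d" "e' \<noteq> d" using Cons.prems(2-5) by metis+
  then have "e \<in> set p" "e' \<in> set p" using Cons.prems(2,3) by auto
  then show ?case using Cons.IH[OF p(1)] Cons.prems(4,5) by blast
qed simp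

lemma apath_determined_by_set:
  assumes "apath u p v" "apath u p' v" "set p = set p'"
  shows "p = p'"
  using assms
proof (induction p arbitrary: u p')
  case (Cons e p)
  from Cons.prems(3) obtain e' q where p': "p' = e' # q" by (cases p') auto
  note e = Cons.prems(1)[unfolded apath_Cons_iff]
  note e' = Cons.prems(2)[unfolded p' apath_Cons_iff]
  have tl: "tail G x \<in> set (awalk_verts (head G e) p)" if "x \<in> set p" for x
    using awalk_verts_arc1[OF that] .
  have tl': "tail G x \<in> set (awalk_verts (head G e') q)" if "x \<in> set q" for x
    using awalk_verts_arc1[OF that] .
  have "e' \<in> set (e # p)" using Cons.prems(3) p' by auto
  then have "e' = e" using e e' tl[of e'] by (metis set_ConsD)
  moreover have "e \<notin> set p" "e' \<notin> set q" using e e' tl tl' by auto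
  ultimately have "set p = set q" using Cons.prems(3) p' by auto
  then have "p = q" using Cons.IH[of "head G e" q] e e' \<open>e' = e\<close> by blast
  then show ?case using p' \<open>e' = e\<close> by simp
qed simp

end

context star_preimage
begin

lemma arcs_GE [consumes 1, case_names out into]:
  assumes "x \<in> arcs G"
  obtains s i where "s \<in> {1..k}" "i \<in> {1..degree P}" "x = edge_out s i"
  | s i where "s \<in> {1..k}" "i \<in> {1..degree P}" "x = edge_in s i"
  using assms unfolding arcs_G by blast

lemma edge_sum_diff: "edge_sum (\<lambda>s i. f s i - g s i) R = edge_sum f R - edge_sum g R"
  by (simp add: edge_sum_def left_diff_distrib sum_subtractf)

lemma edges_independent:
  assumes zero: "\<And>R. edge_sum f R = 0" and s: "s \<in> {1..k}" and i: "i \<in> {1..degree P}"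
  shows "f s i = 0"
proof -
  define Q where "Q = (\<Prod>j\<in>{1..degree P} - {i}. [:- B j c, 1:])"
  have Q: "poly Q (B j c) = 0 \<longleftrightarrow> j \<noteq> i" if "j \<in> {1..degree P}" for j
  proof -
    have "poly Q (B j c) = (\<Prod>m\<in>{1..degree P} - {i}. B j c - B m c)"
      by (simp add: Q_def poly_prod)
    then have "poly Q (B j c) = 0 \<longleftrightarrow> (\<exists>m\<in>{1..degree P} - {i}. B j c = B m c)" by simp
    also have "\<dots> \<longleftrightarrow> j \<noteq> i" using that B_inj[OF that _ center_in_U] by blast
    finally show ?thesis .
  qed
  have "branch_sum (f s) (poly Q) c = 0"
    by (rule branch_sums_vanish) (use zero s center_in_U in auto)
  also have "branch_sum (f s) (poly Q) c = (\<Sum>j=1..degree P. if j = i then f s i * poly Q (B i c) else 0)"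
    unfolding branch_sum_def by (intro sum.cong) (use Q in auto)
  also have "\<dots> = f s i * poly Q (B i c)" using i by simp
  finally show ?thesis using Q[OF i] by simp
qed

lemma finite_preimage: "finite {z. poly P z = w}"
proof -
  have "P - [:w:] \<noteq> 0"
    using degree_pos by (metis degree_pCons_0 eq_iff_diff_eq_0 less_numeral_extra(3))
  from poly_roots_finite[OF this] show ?thesis by simp
qed

lemma verts_G_Un: "verts G = {z. poly P z = c} \<union> {z. poly P z \<in> cs ` {1..k}}"
  by (auto simp: verts_G)

lemma finite_verts_G: "finite (verts G)"
proof -
  have "verts G = (\<Union>w\<in>insert c (cs ` {1..k}). {z. poly P z = w})" by (auto simp: verts_G)
  then show ?thesis using finite_preimage by simp
qed

lemma card_verts_G: "card (verts G) \<le> k * degree P + 1"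
proof -
  have "card {z. poly P z = c} = degree P"
    using bij_betw_same_card[OF B_bij[OF center_in_U]] by simp
  moreover have "card (cs ` {1..k}) = k" using card_image[OF cs_inj] by simp
  then have "card {z. poly P z \<in> cs ` {1..k}} + degree P \<le> degree P * k + 1"
    using card_preimage_critical_le[OF degree_pos, of "cs ` {1..k}"] color_image by auto
  ultimately show ?thesis
    using card_Un_le[of "{z. poly P z = c}" "{z. poly P z \<in> cs ` {1..k}}"]
    by (simp add: verts_G_Un mult.commute)
qed

lemma a_in_G: "a \<in> verts G" and b_in_G: "b \<in> verts G"
  using color_exists[of "poly P a"] color_exists[of "poly P b"] by (auto simp: verts_G)

lemma edge_ends_in_G:
  assumes "s \<in> {1..k}" "i \<in> {1..degree P}"
  shows "endpoint s i \<in> verts G" "B i c \<in> verts G"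
  using assms poly_endpoint poly_B center_in_U by (auto simp: verts_G)

lemma edge_sum_by_vertices:
  "edge_sum f R = (\<Sum>v\<in>verts G. R v * edge_sum f (\<lambda>u. of_bool (u = v)))"
proof -
  have R: "R u = (\<Sum>v\<in>verts G. R v * of_bool (u = v))" if "u \<in> verts G" for u
    using that finite_verts_G by (simp add: of_bool_def sum.delta' if_distrib cong: if_cong)
  have "edge_sum f R = (\<Sum>s=1..k. \<Sum>i=1..degree P. f s i *
      ((\<Sum>v\<in>verts G. R v * of_bool (endpoint s i = v)) - (\<Sum>v\<in>verts G. R v * of_bool (B i c = v))))"
    unfolding edge_sum_def
  proof (intro sum.cong refl)
    fix s i assume "s \<in> {1..k}" "i \<in> {1..degree P}"
    note ends = edge_ends_in_G[OF this]
    show "f s i * (R (endpoint s i) - R (B i c)) = f s i *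
        ((\<Sum>v\<in>verts G. R v * of_bool (endpoint s i = v)) - (\<Sum>v\<in>verts G. R v * of_bool (B i c = v)))"
      by (simp only: R[OF ends(1)] R[OF ends(2)])
  qed
  also have "\<dots> = (\<Sum>s=1..k. \<Sum>i=1..degree P. \<Sum>v\<in>verts G.
      R v * (f s i * (of_bool (endpoint s i = v) - of_bool (B i c = v))))"
    by (simp add: sum_subtractf[symmetric] sum_distrib_left algebra_simps)
  also have "\<dots> = (\<Sum>v\<in>verts G. \<Sum>s=1..k. \<Sum>i=1..degree P.
      R v * (f s i * (of_bool (endpoint s i = v) - of_bool (B i c = v))))"
    by (simp only: sum.swap[of _ "verts G"])
  finally show ?thesis by (simp add: edge_sum_def sum_distrib_left)
qed

text \<open>If \<open>a\<close> and \<open>b\<close> lay in different components, the equations at \<open>a\<close> and \<open>b\<close> would follow from the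
  others, which leaves more edges than equations.\<close>

lemma ends_connected:
  assumes "a \<noteq> b"
  obtains p where "pre_digraph.awalk G a p b"
proof (rule ccontr)
  assume no: "\<not> thesis"
  interpret graph: wf_digraph G by (rule wf_G)
  define A where "A = {v. \<exists>p. graph.awalk a p v}"
  have aA: "a \<in> A" using a_in_G graph.awalk_Nil_iff by (auto simp: A_def)
  have bA: "b \<notin> A" using no that by (auto simp: A_def)
  have closed: "endpoint s i \<in> A \<longleftrightarrow> B i c \<in> A" if "s \<in> {1..k}" "i \<in> {1..degree P}" for s i
  proof -
    have "edge_out s i \<in> arcs G" "edge_in s i \<in> arcs G" using that unfolding arcs_G by blast+
    then have "graph.awalk (B i c) [edge_out s i] (endpoint s i)"
      "graph.awalk (endpoint s i) [edge_in s i] (B i c)"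
      using graph.arc_implies_awalk by fastforce+
    then show ?thesis using graph.awalk_appendI unfolding A_def by blast
  qed
  let ?I = "{1..k} \<times> {1..degree P}"
  let ?d = "\<lambda>(s, i) v. of_bool (endpoint s i = v) - of_bool (B i c = v) :: complex"
  have "card (verts G - {a, b}) = card (verts G) - 2"
    using a_in_G b_in_G assms by (subst card_Diff_subset) auto
  moreover have "0 < k" using color_exists[of "poly P a"] by auto
  then have "0 < k * degree P" using degree_pos by simp
  ultimately have "card (verts G - {a, b}) < k * degree P" using card_verts_G by linarith
  then have "card (verts G - {a, b}) < card ?I" by (simp add: card_cartesian_product)
  then obtain x where x: "\<exists>e\<in>?I. x e \<noteq> 0" "\<And>v. v \<in> verts G - {a, b} \<Longrightarrow> (\<Sum>e\<in>?I. x e * ?d e v) = 0"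
    using homogeneous_system_nontrivial[of "verts G - {a, b}" ?I ?d] finite_verts_G by auto
  define f where "f s i = x (s, i)" for s i
  define D where "D v = edge_sum f (\<lambda>u. of_bool (u = v))" for v
  have D: "D v = (\<Sum>e\<in>?I. x e * ?d e v)" for v
    by (simp add: D_def edge_sum_def f_def sum.cartesian_product split_def)
  have D0: "D v = 0" if "v \<in> verts G" "v \<noteq> a" "v \<noteq> b" for v using x(2)[of v] that by (simp add: D)
  have by_ends: "edge_sum f R = R a * D a + R b * D b" for R
  proof -
    have "edge_sum f R = (\<Sum>v\<in>verts G. R v * D v)" unfolding D_def by (rule edge_sum_by_vertices)
    also have "\<dots> = (\<Sum>v\<in>{a, b}. R v * D v)"
      using D0 a_in_G b_in_G finite_verts_G by (intro sum.mono_neutral_right) auto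
    finally show ?thesis using assms by simp
  qed
  have "edge_sum f (\<lambda>u. of_bool (u \<in> A)) = 0"
    unfolding edge_sum_def using closed by (intro sum.neutral ballI) simp
  then have Da: "D a = 0" using by_ends[of "\<lambda>u. of_bool (u \<in> A)"] aA bA by simp
  moreover have "edge_sum f (\<lambda>_. 1) = 0" by (simp add: edge_sum_def)
  ultimately have "D b = 0" using by_ends[of "\<lambda>_. 1"] by simp
  then have "edge_sum f R = 0" for R using by_ends[of R] Da by simp
  then have "f s i = 0" if "s \<in> {1..k}" "i \<in> {1..degree P}" for s i
    using edges_independent that by blast
  then show False using x(1) by (auto simp: f_def)
qed

definition signed_edges :: "(complex \<times> complex set \<times> complex) list \<Rightarrow> nat \<Rightarrow> nat \<Rightarrow> complex" where
  "signed_edges p s i = of_bool (edge_out s i \<in> set p) - of_bool (edge_in s i \<in> set p)"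

lemma edge_sum_signed_edges:
  assumes p: "pre_digraph.apath G u p v"
  shows "edge_sum (signed_edges p) R = R v - R u"
proof -
  interpret graph: wf_digraph G by (rule wf_G)
  let ?I = "{1..k} \<times> {1..degree P}"
  let ?g = "\<lambda>e. R (head G e) - R (tail G e)"
  let ?out = "\<lambda>(s, i). edge_out s i" and ?in = "\<lambda>(s, i). edge_in s i"
  have w: "graph.awalk u p v" using p by (simp add: graph.apath_def)
  have sub: "set p \<subseteq> arcs G" using w by (simp add: graph.awalk_def)
  have arcs: "arcs G = ?out ` ?I \<union> ?in ` ?I" unfolding arcs_G by auto
  have fin: "finite (arcs G)" unfolding arcs by simp
  have inj: "inj_on ?out ?I" "inj_on ?in ?I"
    by (auto simp: inj_on_def edge_eq_iff simp del: prod.inject)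
  have disj: "?out ` ?I \<inter> ?in ` ?I = {}"
  proof -
    have "?out e \<noteq> ?in e'" if "e \<in> ?I" "e' \<in> ?I" for e e'
      unfolding split_def by (intro edge_eq_iff(3)) (use that in auto)
    then show ?thesis by blast
  qed
  have "R v - R u = (\<Sum>e\<leftarrow>p. ?g e)" by (rule graph.awalk_telescope[OF w, symmetric])
  also have "\<dots> = (\<Sum>e\<in>set p. ?g e)"
    by (rule sum_list_distinct_conv_sum_set[OF graph.apath_imp_distinct[OF p]])
  also have "\<dots> = (\<Sum>e\<in>arcs G. of_bool (e \<in> set p) * ?g e)"
    using sub fin by (intro sum.mono_neutral_cong_left) auto
  also have "\<dots> = (\<Sum>e\<in>?out ` ?I. of_bool (e \<in> set p) * ?g e) + (\<Sum>e\<in>?in ` ?I. of_bool (e \<in> set p) * ?g e)"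
    unfolding arcs by (rule sum.union_disjoint) (use disj in auto)
  also have "\<dots> = (\<Sum>e\<in>?I. of_bool (?out e \<in> set p) * ?g (?out e)) + (\<Sum>e\<in>?I. of_bool (?in e \<in> set p) * ?g (?in e))"
    by (simp only: sum.reindex[OF inj(1)] sum.reindex[OF inj(2)] o_def)
  also have "\<dots> = (\<Sum>(s, i)\<in>?I. signed_edges p s i * (R (endpoint s i) - R (B i c)))"
    unfolding sum.distrib[symmetric]
    by (intro sum.cong refl) (auto simp: signed_edges_def algebra_simps simp del: prod.inject)
  also have "\<dots> = edge_sum (signed_edges p) R"
    by (simp add: edge_sum_def sum.cartesian_product)
  finally show ?thesis by simp
qed

lemma signed_edges_no_backtrack:
  assumes "pre_digraph.apath G u p v"
  shows "\<not> (edge_out s i \<in> set p \<and> edge_in s i \<in> set p)"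
  using wf_digraph.apath_no_backtrack[OF wf_G assms, of "edge_out s i" "edge_in s i"] by auto

lemma apath_unique:
  assumes p: "pre_digraph.apath G u p v" and p': "pre_digraph.apath G u p' v"
  shows "p = p'"
proof -
  interpret graph: wf_digraph G by (rule wf_G)
  have "edge_sum (\<lambda>s i. signed_edges p s i - signed_edges p' s i) R = 0" for R
    unfolding edge_sum_diff edge_sum_signed_edges[OF p] edge_sum_signed_edges[OF p'] by simp
  then have diff0: "signed_edges p s i - signed_edges p' s i = 0" if "s \<in> {1..k}" "i \<in> {1..degree P}" for s i
    using edges_independent[OF _ that] by blast
  have eq: "edge_out s i \<in> set p \<longleftrightarrow> edge_out s i \<in> set p'" "edge_in s i \<in> set p \<longleftrightarrow> edge_in s i \<in> set p'"
    if "s \<in> {1..k}" "i \<in> {1..degree P}" for s i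
  proof -
    have bools: "(A \<longleftrightarrow> C) \<and> (D \<longleftrightarrow> E)"
      if "of_bool A - of_bool D - (of_bool C - of_bool E) = (0::complex)" "\<not> (A \<and> D)" "\<not> (C \<and> E)"
      for A C D E
      using that by (cases A; cases C; cases D; cases E) simp_all
    show "edge_out s i \<in> set p \<longleftrightarrow> edge_out s i \<in> set p'" "edge_in s i \<in> set p \<longleftrightarrow> edge_in s i \<in> set p'"
      using bools[OF _ signed_edges_no_backtrack[OF p] signed_edges_no_backtrack[OF p']]
        diff0[OF that] unfolding signed_edges_def by blast+
  qed
  have "set p \<subseteq> arcs G" "set p' \<subseteq> arcs G"
    using p p' by (auto simp: graph.apath_def graph.awalk_def)
  then have "set p = set p'" using eq unfolding arcs_G by blast
  then show ?thesis by (rule graph.apath_determined_by_set[OF p p'])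
qed

abbreviation \<Gamma> where "\<Gamma> \<equiv> cactus_path P a b k cs c \<gamma>"

lemma apath_cactus_path:
  assumes "a \<noteq> b"
  shows "pre_digraph.apath G a \<Gamma> b"
proof -
  interpret graph: wf_digraph G by (rule wf_G)
  obtain p where "graph.awalk a p b" using ends_connected[OF assms] .
  then have ap: "graph.apath a (graph.awalk_to_apath p) b" by (rule graph.apath_awalk_to_apath)
  show ?thesis
    unfolding cactus_path_def by (rule theI, rule ap, rule apath_unique[OF _ ap])
qed

lemma cactus_coeff_eq:
  assumes ab: "a \<noteq> b" and s: "s \<in> {1..k}" and i: "i \<in> {1..degree P}"
  shows "of_int (cactus_coeff P a b k cs c \<gamma> B s i) = signed_edges \<Gamma> s i"
proof -
  interpret graph: wf_digraph G by (rule wf_G)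
  note ap = apath_cactus_path[OF ab]
  have sub: "set \<Gamma> \<subseteq> arcs G" using ap by (auto simp: graph.apath_def graph.awalk_def)
  have w: "poly P (B j c) = c" if "j \<in> {1..degree P}" for j using poly_B[OF that center_in_U] .
  have cne: "c \<noteq> cs t" if "t \<in> {1..k}" for t using center_not_color that by blast
  have "(v, e, B i c) = edge_in s i" if e: "(v, e, B i c) \<in> arcs G" and v: "poly P v = cs s" for v e
    using e
  proof (cases rule: arcs_GE)
    case (out t j)
    then show ?thesis using w[OF i] poly_endpoint[of t j] cne[of t] by auto
  next
    case (into t j)
    then have "j = i" "t = s"
      using B_inj[OF i into(2) center_in_U] v poly_endpoint[OF into(1,2)] inj_onD[OF cs_inj _ s into(1)]
      by auto
    then show ?thesis using into(3) by simp
  qed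
  moreover have "(B i c, e, v) = edge_out s i" if e: "(B i c, e, v) \<in> arcs G" and v: "poly P v = cs s" for v e
    using e
  proof (cases rule: arcs_GE)
    case (out t j)
    then have "j = i" "t = s"
      using B_inj[OF i out(2) center_in_U] v poly_endpoint[OF out(1,2)] inj_onD[OF cs_inj _ s out(1)]
      by auto
    then show ?thesis using out(3) by simp
  next
    case (into t j)
    then show ?thesis using w[OF i] poly_endpoint[of t j] cne[of t] by auto
  qed
  ultimately have
    "(\<exists>v e. poly P v = cs s \<and> e \<subseteq> cactus_star k cs \<gamma> B i \<and> (v, e, B i c) \<in> set \<Gamma>) \<longleftrightarrow> edge_in s i \<in> set \<Gamma>"
    "(\<exists>v e. poly P v = cs s \<and> e \<subseteq> cactus_star k cs \<gamma> B i \<and> (B i c, e, v) \<in> set \<Gamma>) \<longleftrightarrow> edge_out s i \<in> set \<Gamma>"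
    using sub edge_subset_star[OF s i] poly_endpoint[OF s i] by (metis subsetD)+
  then show ?thesis
    using signed_edges_no_backtrack[OF ap, where s = s and i = i]
    by (simp add: cactus_coeff_def Let_def signed_edges_def)
qed

lemma cactus_phi_eq:
  assumes "a \<noteq> b" "s \<in> {1..k}"
  shows "cactus_phi P Q a b k cs c \<gamma> B s z = branch_sum (signed_edges \<Gamma> s) (poly Q) z"
  unfolding cactus_phi_def branch_sum_def using cactus_coeff_eq[OF assms] by (intro sum.cong) auto

end

section \<open>Moments\<close>

lemma vanishing_moments_iff:
  fixes P q Q :: "complex poly"
  assumes Q: "pderiv Q = q" "poly Q a = 0" "poly Q b = 0"
  shows "(\<forall>i::nat. contour_integral (linepath a b) (\<lambda>z. poly P z ^ i * poly q z) = 0) \<longleftrightarrow>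
    (\<forall>m::nat. contour_integral (linepath a b) (\<lambda>z. poly P z ^ m * poly (pderiv P * Q) z) = 0)"
    (is "?L \<longleftrightarrow> ?R")
proof -
  let ?I = "\<lambda>f. contour_integral (linepath a b) f"
  have deriv: "((\<lambda>z. poly P z ^ m * poly Q z) has_field_derivative
      poly P z ^ m * poly q z + of_nat m * (poly P z ^ (m - 1) * poly (pderiv P * Q) z)) (at z)" for m z
    by (auto intro!: derivative_eq_intros poly_DERIV simp: Q(1) algebra_simps)
  have int: "f contour_integrable_on linepath a b" if "continuous_on UNIV f" for f
    using that by (intro contour_integrable_continuous_linepath) (auto intro: continuous_on_subset)
  have sum: "?I (\<lambda>z. poly P z ^ m * poly q z) + of_nat m * ?I (\<lambda>z. poly P z ^ (m - 1) * poly (pderiv P * Q) z) = 0"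
    for m
  proof -
    have "((\<lambda>z. poly P z ^ m * poly q z + of_nat m * (poly P z ^ (m - 1) * poly (pderiv P * Q) z))
        has_contour_integral 0) (linepath a b)"
      using contour_integral_primitive[OF has_field_derivative_at_within[OF deriv], of "linepath a b" UNIV m] Q
      by simp
    then have "0 = ?I (\<lambda>z. poly P z ^ m * poly q z + of_nat m * (poly P z ^ (m - 1) * poly (pderiv P * Q) z))"
      by (simp only: contour_integral_unique)
    also have "\<dots> = ?I (\<lambda>z. poly P z ^ m * poly q z)
        + of_nat m * ?I (\<lambda>z. poly P z ^ (m - 1) * poly (pderiv P * Q) z)"
      by (subst contour_integral_add, (intro int continuous_intros)+, subst contour_integral_lmul)
        (intro int continuous_intros refl)+
    finally show ?thesis by simp
  qed
  show ?thesis
  proof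
    assume L: ?L
    show ?R
    proof
      fix m show "?I (\<lambda>z. poly P z ^ m * poly (pderiv P * Q) z) = 0"
        using sum[of "Suc m"] L[rule_format, of "Suc m"] by (simp del: of_nat_Suc poly_mult power_Suc)
    qed
  next
    assume R: ?R
    show ?L
    proof
      fix i show "?I (\<lambda>z. poly P z ^ i * poly q z) = 0"
        using sum[of i] R[rule_format, of "i - 1"] by (simp del: poly_mult)
    qed
  qed
qed

text \<open>The integrand is \<open>- N / t\<close> times a geometric series in \<open>P / t\<close>.\<close>

lemma Cauchy_transform_zero_if_moments_vanish:
  fixes P N :: "complex poly"
  assumes moments: "\<And>m. contour_integral (linepath a b) (\<lambda>z. poly P z ^ m * poly N z) = 0"
  obtains M where "\<And>t. M < norm t \<Longrightarrow> contour_integral (linepath a b) (\<lambda>z. poly N z / (poly P z - t)) = 0"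
proof -
  let ?I = "\<lambda>f. contour_integral (linepath a b) f" and ?s = "closed_segment a b"
  have "bounded (poly P ` ?s)" "bounded (poly N ` ?s)"
    by (intro compact_imp_bounded compact_continuous_image continuous_intros compact_segment)+
  then obtain M1 C where MC: "\<And>z. z \<in> ?s \<Longrightarrow> norm (poly P z) \<le> M1" "\<And>z. z \<in> ?s \<Longrightarrow> norm (poly N z) \<le> C"
    unfolding bounded_iff by blast
  have nonneg: "0 \<le> M1" "0 \<le> C"
    using MC[OF ends_in_segment(1)] norm_ge_zero order_trans by blast+
  have "?I (\<lambda>z. poly N z / (poly P z - t)) = 0" if t: "M1 < norm t" for t
  proof -
    have t0: "t \<noteq> 0" using t nonneg by auto
    have ne: "poly P z - t \<noteq> 0" if "z \<in> ?s" for z using MC(1)[OF that] t by auto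
    have int: "(\<lambda>z. (poly P z / t) ^ j * poly N z / (poly P z - t)) contour_integrable_on linepath a b" for j
      by (intro contour_integrable_continuous_linepath continuous_intros) (use t0 ne in auto)
    have step: "?I (\<lambda>z. (poly P z / t) ^ Suc j * poly N z / (poly P z - t)) =
        ?I (\<lambda>z. (poly P z / t) ^ j * poly N z / (poly P z - t))" for j
    proof -
      have "?I (\<lambda>z. (poly P z / t) ^ Suc j * poly N z / (poly P z - t))
          - ?I (\<lambda>z. (poly P z / t) ^ j * poly N z / (poly P z - t)) =
        ?I (\<lambda>z. (poly P z / t) ^ Suc j * poly N z / (poly P z - t) - (poly P z / t) ^ j * poly N z / (poly P z - t))"
        by (rule contour_integral_diff[OF int int, symmetric])
      also have "\<dots> = ?I (\<lambda>z. (1 / t ^ Suc j) * (poly P z ^ j * poly N z))"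
      proof (rule contour_integral_eq)
        fix z assume "z \<in> path_image (linepath a b)"
        then have "poly P z - t \<noteq> 0" using ne by simp
        then show "(poly P z / t) ^ Suc j * poly N z / (poly P z - t) - (poly P z / t) ^ j * poly N z / (poly P z - t)
            = (1 / t ^ Suc j) * (poly P z ^ j * poly N z)"
          using t0 by (simp add: divide_simps power_divide) (simp add: algebra_simps)
      qed
      also have "\<dots> = (1 / t ^ Suc j) * ?I (\<lambda>z. poly P z ^ j * poly N z)"
        by (intro contour_integral_lmul contour_integrable_continuous_linepath continuous_intros)
      finally show ?thesis using moments by simp
    qed
    have all: "?I (\<lambda>z. poly N z / (poly P z - t)) = ?I (\<lambda>z. (poly P z / t) ^ j * poly N z / (poly P z - t))" for j
      by (induction j) (simp_all only: step power_0 mult_1_left)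
    define q where "q = M1 / norm t"
    have q: "0 \<le> q" "q < 1" using nonneg t by (auto simp: q_def divide_less_eq)
    define D where "D = C / (norm t - M1) * norm (b - a)"
    have bound: "norm (?I (\<lambda>z. poly N z / (poly P z - t))) \<le> D * q ^ j" for j
    proof -
      have "norm (?I (\<lambda>z. (poly P z / t) ^ j * poly N z / (poly P z - t))) \<le> (q ^ j * C / (norm t - M1)) * norm (b - a)"
      proof (rule contour_integral_bound_linepath[OF int])
        show "0 \<le> q ^ j * C / (norm t - M1)" using q nonneg t by simp
        fix z assume z: "z \<in> ?s"
        have "norm (poly P z - t) \<ge> norm t - M1"
          using norm_triangle_ineq2[of t "poly P z"] MC(1)[OF z] by (simp add: norm_minus_commute)
        moreover have "norm (poly P z / t) ^ j \<le> q ^ j"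
          unfolding q_def norm_divide using MC(1)[OF z] by (intro power_mono divide_right_mono) auto
        ultimately show "norm ((poly P z / t) ^ j * poly N z / (poly P z - t)) \<le> q ^ j * C / (norm t - M1)"
          unfolding norm_divide[of _ "poly P z - t"] norm_mult norm_power
          using MC(2)[OF z] t q nonneg by (intro frac_le mult_mono) auto
      qed
      then show ?thesis unfolding all[of j] D_def by (simp add: mult_ac)
    qed
    have "(\<lambda>j. D * q ^ j) \<longlonglongrightarrow> D * 0"
      using q by (intro tendsto_mult_left LIMSEQ_realpow_zero)
    then have "norm (?I (\<lambda>z. poly N z / (poly P z - t))) \<le> 0"
      using bound by (intro LIMSEQ_le_const) auto
    then show ?thesis by simp
  qed
  then show ?thesis using that by blast
qed

context star_preimage
begin

lemma moments_vanish_imp_branch_sums_vanish: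
  assumes ab: "a \<noteq> b" and s: "s \<in> {1..k}" and z: "z \<in> U"
    and moments: "\<And>m. contour_integral (linepath a b) (\<lambda>z. poly P z ^ m * poly (pderiv P * Q) z) = 0"
  shows "branch_sum (signed_edges \<Gamma> s) (poly Q) z = 0"
proof (rule branch_sums_vanish[OF _ s z])
  let ?N = "pderiv P * Q"
  obtain M where M: "\<And>t. M < norm t \<Longrightarrow> contour_integral (linepath a b) (\<lambda>z. poly ?N z / (poly P z - t)) = 0"
    using Cauchy_transform_zero_if_moments_vanish[OF moments] by blast
  have "edge_sum (signed_edges \<Gamma>) g = 0"
    if R: "norm a + norm b + 1 \<le> R" and t: "M < norm t"
      and g: "\<forall>z\<in>ball 0 R. (g has_field_derivative poly ?N z / (poly P z - t)) (at z)" for R t g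
  proof -
    have "closed_segment a b \<subseteq> ball 0 R"
      using R norm_ge_zero[of a] norm_ge_zero[of b] by (intro closed_segment_subset) (auto simp del: norm_ge_zero)
    then have "((\<lambda>z. poly ?N z / (poly P z - t)) has_contour_integral g b - g a) (linepath a b)"
      using contour_integral_primitive[of "ball 0 R" g "\<lambda>z. poly ?N z / (poly P z - t)" "linepath a b"] g
      by (simp add: has_field_derivative_at_within del: poly_mult)
    then have "g b - g a = 0" using M[OF t] contour_integral_unique by metis
    then show ?thesis using edge_sum_signed_edges[OF apath_cactus_path[OF ab], of g] by simp
  qed
  then show "\<exists>R0. \<forall>R\<ge>R0. \<exists>M. \<forall>t. M < norm t \<longrightarrow> (\<forall>g.
      (\<forall>z\<in>ball 0 R. (g has_field_derivative poly ?N z / (poly P z - t)) (at z)) \<longrightarrow>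
      edge_sum (signed_edges \<Gamma>) g = 0)"
    by blast
qed

lemma branch_sums_vanish_imp_moments_vanish:
  assumes ab: "a \<noteq> b"
    and zero: "\<And>s z. s \<in> {1..k} \<Longrightarrow> z \<in> U \<Longrightarrow> branch_sum (signed_edges \<Gamma> s) (poly Q) z = 0"
  shows "contour_integral (linepath a b) (\<lambda>z. poly P z ^ m * poly (pderiv P * Q) z) = 0"
proof -
  let ?h = "\<lambda>z. poly P z ^ m * poly (pderiv P * Q) z"
  have "?h holomorphic_on UNIV" by (intro holomorphic_intros)
  then obtain R where R: "\<And>z. (R has_field_derivative ?h z) (at z)"
    using holomorphic_convex_primitive'[OF convex_UNIV open_UNIV, of ?h] by auto
  have "(\<Sum>i=1..degree P. signed_edges \<Gamma> s i * (R (endpoint s i) - R (B i c))) = 0" if s: "s \<in> {1..k}" for s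
  proof -
    let ?F = "branch_sum (signed_edges \<Gamma> s) R"
    have deriv: "(?F has_field_derivative 0) (at u)" if u: "u \<in> U" for u
    proof -
      have "(R has_field_derivative poly (pderiv P) (B i u) * u ^ m * poly Q (B i u)) (at (B i u))"
        if "i \<in> {1..degree P}" for i
        using R[of "B i u"] poly_B[OF that u] by (simp add: mult_ac)
      then have "(?F has_field_derivative u ^ m * branch_sum (signed_edges \<Gamma> s) (poly Q) u) (at u)"
        by (rule branch_sum_has_derivative[OF u])
      then show ?thesis using zero[OF s u] by simp
    qed
    have "continuous_on U ?F"
      using deriv DERIV_isCont by (blast intro: continuous_at_imp_continuous_on)
    then obtain C where C: "\<And>u. u \<in> U \<Longrightarrow> ?F u = C"
      using DERIV_zero_connected_constant[OF connected_U open_U finite.emptyI] deriv by blast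
    have "((\<lambda>x. ?F (\<gamma> s x)) \<longlongrightarrow> (\<Sum>i=1..degree P. signed_edges \<Gamma> s i * R (endpoint s i))) (at_left 1)"
      unfolding branch_sum_def
    proof (intro tendsto_sum tendsto_mult tendsto_const)
      fix i assume i: "i \<in> {1..degree P}"
      show "((\<lambda>x. R (B i (\<gamma> s x))) \<longlongrightarrow> R (endpoint s i)) (at_left 1)"
        using isCont_tendsto_compose[OF DERIV_isCont[OF R] B_\<gamma>_tendsto[OF s i]] .
    qed
    moreover have "\<forall>\<^sub>F x in at_left 1. ?F (\<gamma> s x) = C"
      unfolding eventually_at_left_field using C \<gamma>_in_U[OF s] by (intro exI[of _ 0]) auto
    then have "((\<lambda>x. ?F (\<gamma> s x)) \<longlongrightarrow> C) (at_left 1)" by (simp add: tendsto_eventually)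
    ultimately have "(\<Sum>i=1..degree P. signed_edges \<Gamma> s i * R (endpoint s i)) = ?F c"
      using C[OF center_in_U] tendsto_unique[OF trivial_limit_at_left_real] by blast
    then show ?thesis by (simp add: branch_sum_def right_diff_distrib sum_subtractf)
  qed
  then have "R b - R a = 0"
    using edge_sum_signed_edges[OF apath_cactus_path[OF ab], of R] by (simp add: edge_sum_def)
  moreover have "(?h has_contour_integral R b - R a) (linepath a b)"
    using contour_integral_primitive[OF has_field_derivative_at_within[OF R], of "linepath a b" UNIV] by simp
  ultimately show ?thesis using contour_integral_unique by metis
qed

end

theorem theorem2p1:
  fixes P q Q :: "complex poly" and a b c :: complex and k :: nat
    and cs :: "nat \<Rightarrow> complex" and \<gamma> :: "nat \<Rightarrow> real \<Rightarrow> complex"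
    and U :: "complex set" and B :: "nat \<Rightarrow> complex \<Rightarrow> complex"
  assumes "degree P > 0"
    and "a \<noteq> b"
    and "pderiv Q = q" and "poly Q a = 0" and "poly Q b = 0"
    and "cactus_colors P a b k cs"
    and "star_arcs k cs c \<gamma>"
    and "star_domain P k cs \<gamma> U"
    and "inverse_branches P U B"
  shows "(\<forall>i::nat. contour_integral (linepath a b) (\<lambda>z. poly P z ^ i * poly q z) = 0) \<longleftrightarrow>
         (\<forall>s\<in>{1..k}. \<forall>z\<in>U. cactus_phi P Q a b k cs c \<gamma> B s z = 0)"
proof -
  interpret star_preimage P a b c k cs \<gamma> U B
    using assms by unfold_locales
  show ?thesis
    unfolding vanishing_moments_iff[OF assms(3-5)]
  proof (intro iffI allI ballI)
    fix s z
    assume "\<forall>m. contour_integral (linepath a b) (\<lambda>z. poly P z ^ m * poly (pderiv P * Q) z) = 0"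
      and s: "s \<in> {1..k}" and "z \<in> U"
    then show "cactus_phi P Q a b k cs c \<gamma> B s z = 0"
      unfolding cactus_phi_eq[OF assms(2) s]
      by (intro moments_vanish_imp_branch_sums_vanish[OF assms(2)]) blast+
  next
    fix m
    assume "\<forall>s\<in>{1..k}. \<forall>z\<in>U. cactus_phi P Q a b k cs c \<gamma> B s z = 0"
    then show "contour_integral (linepath a b) (\<lambda>z. poly P z ^ m * poly (pderiv P * Q) z) = 0"
      using cactus_phi_eq[OF assms(2)]
      by (intro branch_sums_vanish_imp_moments_vanish[OF assms(2)]) metis
  qed
qed

end
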